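(* Let $f:2^{\omega}\to\mathcal{M}$ be a computable function that is injective on an effectively closed set $\mathcal{D}\subseteq2^{\omega}$, and let $\mathcal{D}^{*}\subseteq\mathcal{D}$ be a set of computable reals. If $f(\mathcal{D}^{*})$ is a partially EX-learnable class of computable measures, then $\mathcal{D}^{*}$ is an EX-learnable class of computable reals.
   Context: $\mathcal{M}$ is the space of Borel probability measures on $2^\omega$ (measures identified with $\sigma\mapsto\mu([\sigma])$), with the usual computable metric structure whose basic open sets are $\{\mu:\mu(\sigma_i)\in I_i,\ i\le n\}$ for rational open intervals $I_i$. A function $f:2^\omega\to\mathcal{M}$ is computable if there is a computable monotone map $f^*$ from binary strings to basic open sets of $\mathcal{M}$ with $f(Z)\in f^*(Z\upharpoonright n)$ for all $n$ and the diameter of $f^*(Z\upharpoonright n)$ tending to $0$ for every $Z$. $\mathcal{D}$ is effectively closed if its complement is the union of a c.e. set of cylinders $[\sigma]$. Fix a uniform enumeration $(\mu_e)$ of partial computable measures ($e$ index of computable $\mu$ if $\mu_e$ total and equal to $\mu$) and an acceptable numbering $(\varphi_e)$ of partial computable $\{0,1\}$-valued functions ($e$ index of computable real $Z$ if $\varphi_e=Z$). For computable $\mu$, $X$ is $\mu$-random if Martin-Löf random with respect to $\mu$. A class $\mathcal{C}$ of computable reals is EX-learnable if some computable $\mathcal{L}:2^{<\omega}\to\mathbb{N}$ satisfies: for every $Z\in\mathcal{C}$, $\lim_n\mathcal{L}(Z\upharpoonright n)$ exists and is an index of $Z$. A class $\mathcal{C}$ of computable measures is partially EX-learnable if there is a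 computable $\mathcal{V}:2^{<\omega}\to\mathbb{N}$ such that (a) for every $\mu\in\mathcal{C}$ and every $\mu$-random $X$, $\lim_n\mathcal{V}(X\upharpoonright n)$ exists and is an index of a computable measure $\mu'$ (not necessarily in $\mathcal{C}$) with $X$ $\mu'$-random; and (b) for every $\mu\in\mathcal{C}$ there is a $\mu$-random $X$ such that $\lim_n\mathcal{V}(X\upharpoonright n)$ is an index of $\mu$. *)

theory Defs
  imports "HOL-Probability.Probability" "HOL-Library.Nat_Bijection" "HOL-Library.Sublist"
begin

section \<open>Computability\<close>

text \<open>Partial recursive functions in one argument. Several arguments are passed through the
  (computable) Cantor pairing \<open>prod_encode\<close>, whose two projections are among the initial
  functions.\<close>

inductive partrec :: "(nat \<Rightarrow> nat option) \<Rightarrow> bool" where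
  zero: "partrec (\<lambda>_. Some 0)"
| succ: "partrec (\<lambda>n. Some (Suc n))"
| left: "partrec (\<lambda>n. Some (fst (prod_decode n)))"
| right: "partrec (\<lambda>n. Some (snd (prod_decode n)))"
| pair: "partrec f \<Longrightarrow> partrec g \<Longrightarrow>
    partrec (\<lambda>n. Option.bind (f n) (\<lambda>a. Option.bind (g n) (\<lambda>b. Some (prod_encode (a, b)))))"
| comp: "partrec f \<Longrightarrow> partrec g \<Longrightarrow> partrec (\<lambda>n. Option.bind (g n) f)"
| prec: "partrec f \<Longrightarrow> partrec g \<Longrightarrow>
    partrec (\<lambda>n. rec_nat (f (fst (prod_decode n)))
      (\<lambda>y r. Option.bind r (\<lambda>i. g (prod_encode (fst (prod_decode n), prod_encode (y, i)))))
      (snd (prod_decode n)))"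
| minim: "partrec f \<Longrightarrow>
    partrec (\<lambda>a. if \<exists>n. f (prod_encode (a, n)) = Some 0 \<and> (\<forall>k<n. f (prod_encode (a, k)) \<noteq> None)
      then Some (LEAST n. f (prod_encode (a, n)) = Some 0) else None)"

text \<open>Fixed effective injective codings of the finite objects that occur.\<close>

class encodable =
  fixes encode :: "'a \<Rightarrow> nat"
  assumes inj_encode: "inj encode"

instantiation nat :: encodable
begin
definition encode_nat :: "nat \<Rightarrow> nat" where "encode_nat n = n"
instance by standard (simp add: inj_on_def encode_nat_def)
end

instantiation bool :: encodable
begin
definition encode_bool :: "bool \<Rightarrow> nat" where "encode_bool b = of_bool b"
instance by standard (simp add: inj_on_def encode_bool_def)
end

instantiation int :: encodable
begin
definition encode_int :: "int \<Rightarrow> nat" where "encode_int i = int_encode i"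
instance by standard (simp add: inj_on_def encode_int_def int_encode_eq)
end

instantiation prod :: (encodable, encodable) encodable
begin
definition encode_prod :: "'a \<times> 'b \<Rightarrow> nat" where
  "encode_prod p = prod_encode (encode (fst p), encode (snd p))"
instance
  by standard (auto simp: inj_on_def encode_prod_def dest: injD[OF inj_encode])
end

instantiation list :: (encodable) encodable
begin
definition encode_list :: "'a list \<Rightarrow> nat" where
  "encode_list xs = list_encode (map encode xs)"
instance
  by standard (auto simp: inj_on_def encode_list_def list_encode_eq inj_map_eq_map[OF inj_encode])
end

instantiation rat :: encodable
begin
definition encode_rat :: "rat \<Rightarrow> nat" where "encode_rat q = encode (quotient_of q)"
instance
  by standard (auto simp: inj_on_def encode_rat_def quotient_of_inject dest: injD[OF inj_encode])
end

definition pcomputable :: "('a::encodable \<Rightarrow> 'b::encodable option) \<Rightarrow> bool" where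
  "pcomputable p \<longleftrightarrow> (\<exists>h. partrec h \<and> (\<forall>x. h (encode x) = map_option encode (p x)))"

definition computable :: "('a::encodable \<Rightarrow> 'b::encodable) \<Rightarrow> bool" where
  "computable f \<longleftrightarrow> pcomputable (\<lambda>x. Some (f x))"

definition ce :: "'a::encodable set \<Rightarrow> bool" where
  "ce A \<longleftrightarrow> (\<exists>p :: 'a \<Rightarrow> nat option. pcomputable p \<and> dom p = A)"

text \<open>Acceptable numberings of the partial computable \<open>{0,1}\<close>-valued functions: uniformly
  partial computable, and every uniformly partial computable sequence can be effectively
  translated into the numbering. (In particular every such function has an index.)\<close>

definition acceptable_numbering :: "(nat \<Rightarrow> nat \<Rightarrow> bool option) \<Rightarrow> bool" where
  "acceptable_numbering \<phi> \<longleftrightarrow>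
     pcomputable (\<lambda>(e, n). \<phi> e n) \<and>
     (\<forall>g :: nat \<Rightarrow> nat \<Rightarrow> bool option. pcomputable (\<lambda>(x, n). g x n) \<longrightarrow>
        (\<exists>s :: nat \<Rightarrow> nat. computable s \<and> (\<forall>x. \<phi> (s x) = g x)))"


section \<open>Cantor space and its Borel probability measures\<close>

text \<open>Reals are elements of Cantor space \<^typ>\<open>nat \<Rightarrow> bool\<close>, with the product topology.\<close>

definition restr :: "(nat \<Rightarrow> bool) \<Rightarrow> nat \<Rightarrow> bool list" (infix "\<restriction>" 95) where
  "Z \<restriction> n = map Z [0..<n]"

definition cyl :: "bool list \<Rightarrow> (nat \<Rightarrow> bool) set" where
  "cyl \<sigma> = {X. X \<restriction> length \<sigma> = \<sigma>}"

definition effectively_closed :: "(nat \<Rightarrow> bool) set \<Rightarrow> bool" where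
  "effectively_closed D \<longleftrightarrow> (\<exists>W. ce W \<and> - D = (\<Union>\<sigma>\<in>W. cyl \<sigma>))"

definition prob_measures :: "(nat \<Rightarrow> bool) measure set" where
  "prob_measures = {\<mu>. prob_space \<mu> \<and> sets \<mu> = sets borel}"

text \<open>The usual metric on the space of measures,
  \<open>d(\<mu>, \<nu>) = \<Sum>n. 2^-n * max {\<bar>\<mu>(\<sigma>) - \<nu>(\<sigma>)\<bar> : length \<sigma> = n}\<close>.\<close>

definition measure_dist :: "(nat \<Rightarrow> bool) measure \<Rightarrow> (nat \<Rightarrow> bool) measure \<Rightarrow> real" where
  "measure_dist \<mu> \<nu> =
     (\<Sum>n. (1/2) ^ n * (MAX \<sigma>\<in>{\<sigma>. length \<sigma> = n}. \<bar>measure \<mu> (cyl \<sigma>) - measure \<nu> (cyl \<sigma>)\<bar>))"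

definition measure_diam :: "(nat \<Rightarrow> bool) measure set \<Rightarrow> real" where
  "measure_diam S = (SUP (\<mu>, \<nu>)\<in>S \<times> S. measure_dist \<mu> \<nu>)"

text \<open>A triple \<open>(\<sigma>, a, b)\<close> stands for the condition that \<open>\<mu>(\<sigma>)\<close> lies in the rational open
  interval \<open>(a, b)\<close>.\<close>

definition basic_open :: "(bool list \<times> rat \<times> rat) list \<Rightarrow> (nat \<Rightarrow> bool) measure set" where
  "basic_open cs = {\<mu> \<in> prob_measures.
     \<forall>(\<sigma>, a, b) \<in> set cs. measure \<mu> (cyl \<sigma>) \<in> {of_rat a <..< of_rat b}}"

definition computable_measure_map :: "((nat \<Rightarrow> bool) \<Rightarrow> (nat \<Rightarrow> bool) measure) \<Rightarrow> bool" where
  "computable_measure_map f \<longleftrightarrow> (\<forall>Z. f Z \<in> prob_measures) \<and>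
     (\<exists>F. computable F \<and>
        (\<forall>\<sigma> \<tau>. prefix \<sigma> \<tau> \<longrightarrow> basic_open (F \<tau>) \<subseteq> basic_open (F \<sigma>)) \<and>
        (\<forall>Z n. f Z \<in> basic_open (F (Z \<restriction> n))) \<and>
        (\<forall>Z. (\<lambda>n. measure_diam (basic_open (F (Z \<restriction> n)))) \<longlonglongrightarrow> 0))"


section \<open>Computable measures and randomness\<close>

definition computable_measure :: "(nat \<Rightarrow> bool) measure \<Rightarrow> bool" where
  "computable_measure \<mu> \<longleftrightarrow> \<mu> \<in> prob_measures \<and>
     (\<exists>a :: bool list \<times> nat \<Rightarrow> rat. computable a \<and>
        (\<forall>\<sigma> k. \<bar>of_rat (a (\<sigma>, k)) - measure \<mu> (cyl \<sigma>)\<bar> \<le> (1/2) ^ k))"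

text \<open>A partial computable measure is given by a partial computable \<open>p\<close>, where \<open>p \<sigma> k\<close>, if
  defined, approximates the measure of \<open>cyl \<sigma>\<close> with error at most \<open>2^-k\<close>; the values that are
  defined must be consistent with some measure.\<close>

definition partial_computable_measure :: "(bool list \<Rightarrow> nat \<Rightarrow> rat option) \<Rightarrow> bool" where
  "partial_computable_measure p \<longleftrightarrow> pcomputable (\<lambda>(\<sigma>, k). p \<sigma> k) \<and>
     (\<exists>\<mu>\<in>prob_measures. \<forall>\<sigma> k q. p \<sigma> k = Some q \<longrightarrow>
        \<bar>of_rat q - measure \<mu> (cyl \<sigma>)\<bar> \<le> (1/2) ^ k)"

definition uniform_measure_enumeration :: "(nat \<Rightarrow> bool list \<Rightarrow> nat \<Rightarrow> rat option) \<Rightarrow> bool" where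
  "uniform_measure_enumeration m \<longleftrightarrow>
     pcomputable (\<lambda>(e, \<sigma>, k). m e \<sigma> k) \<and> range m = {p. partial_computable_measure p}"

definition measure_index ::
    "(nat \<Rightarrow> bool list \<Rightarrow> nat \<Rightarrow> rat option) \<Rightarrow> nat \<Rightarrow> (nat \<Rightarrow> bool) measure \<Rightarrow> bool" where
  "measure_index m e \<mu> \<longleftrightarrow> \<mu> \<in> prob_measures \<and>
     (\<forall>\<sigma> k. \<exists>q. m e \<sigma> k = Some q \<and> \<bar>of_rat q - measure \<mu> (cyl \<sigma>)\<bar> \<le> (1/2) ^ k)"

definition real_index :: "(nat \<Rightarrow> nat \<Rightarrow> bool option) \<Rightarrow> nat \<Rightarrow> (nat \<Rightarrow> bool) \<Rightarrow> bool" where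
  "real_index \<phi> e Z \<longleftrightarrow> \<phi> e = (\<lambda>n. Some (Z n))"

definition test_level :: "(nat \<times> bool list) set \<Rightarrow> nat \<Rightarrow> (nat \<Rightarrow> bool) set" where
  "test_level W i = (\<Union>\<sigma>\<in>{\<sigma>. (i, \<sigma>) \<in> W}. cyl \<sigma>)"

definition ml_test :: "(nat \<Rightarrow> bool) measure \<Rightarrow> (nat \<times> bool list) set \<Rightarrow> bool" where
  "ml_test \<mu> W \<longleftrightarrow> ce W \<and> (\<forall>i. measure \<mu> (test_level W i) \<le> (1/2) ^ i)"

definition ml_random :: "(nat \<Rightarrow> bool) measure \<Rightarrow> (nat \<Rightarrow> bool) \<Rightarrow> bool" where
  "ml_random \<mu> X \<longleftrightarrow> (\<forall>W. ml_test \<mu> W \<longrightarrow> X \<notin> (\<Inter>i. test_level W i))"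


section \<open>Learnability\<close>

definition EX_learnable :: "(nat \<Rightarrow> nat \<Rightarrow> bool option) \<Rightarrow> (nat \<Rightarrow> bool) set \<Rightarrow> bool" where
  "EX_learnable \<phi> C \<longleftrightarrow> (\<forall>Z\<in>C. computable Z) \<and>
     (\<exists>L :: bool list \<Rightarrow> nat. computable L \<and>
        (\<forall>Z\<in>C. \<exists>e. (\<lambda>n. L (Z \<restriction> n)) \<longlonglongrightarrow> e \<and> real_index \<phi> e Z))"

definition partially_EX_learnable ::
    "(nat \<Rightarrow> bool list \<Rightarrow> nat \<Rightarrow> rat option) \<Rightarrow> (nat \<Rightarrow> bool) measure set \<Rightarrow> bool" where
  "partially_EX_learnable m C \<longleftrightarrow> (\<forall>\<mu>\<in>C. computable_measure \<mu>) \<and>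
     (\<exists>V :: bool list \<Rightarrow> nat. computable V \<and>
        (\<forall>\<mu>\<in>C. \<forall>X. ml_random \<mu> X \<longrightarrow>
           (\<exists>e \<mu>'. (\<lambda>n. V (X \<restriction> n)) \<longlonglongrightarrow> e \<and>
              computable_measure \<mu>' \<and> measure_index m e \<mu>' \<and> ml_random \<mu>' X)) \<and>
        (\<forall>\<mu>\<in>C. \<exists>X e. ml_random \<mu> X \<and> (\<lambda>n. V (X \<restriction> n)) \<longlonglongrightarrow> e \<and> measure_index m e \<mu>))"

end

theory Submission
  imports Defs
begin

text \<open>Write \<open>\<mu> = f Z\<close>. The learner guesses a string \<open>\<tau>\<close>, an index \<open>e\<close> and a bound \<open>2^-j\<close> such that the
  class \<open>P\<close> of reals extending \<open>\<tau>\<close> on which \<open>V\<close> never again changes its value \<open>e\<close> has \<open>\<mu>\<close>-measure at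
  least \<open>2^-j\<close>, and \<open>e\<close> is an index of \<open>\<mu>\<close>. Refuting such a hypothesis is \<open>\<Sigma>\<^sub>1\<close> in \<open>Z\<close>, so in the limit
  the learner finds the least hypothesis that is never refuted. One exists: clause (b) gives a
  \<open>\<mu>\<close>-random real in such a \<open>P\<close>, and an effectively closed class containing a \<open>\<mu>\<close>-random real is not
  \<open>\<mu>\<close>-null. Conversely, if a hypothesis is never refuted, then \<open>P\<close> has positive measure and hence
  contains a \<open>\<mu>\<close>-random real, so by clause (a) the partial measure with index \<open>e\<close> is total; since it
  never conflicts with \<open>\<mu>\<close>, it is \<open>\<mu>\<close>. Finally, \<open>Z\<close> is the only element of \<open>D\<close> whose image is \<open>\<mu>\<close>, and by
  compactness it can be computed uniformly from \<open>e\<close>.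

  That \<open>\<mu>(C) < q\<close> is \<open>\<Sigma>\<^sub>1\<close> in \<open>Z\<close> for clopen \<open>C\<close> is verified on finite samples: every sample of points that
  roughly satisfies the constraints of some \<open>F (Z \<restriction> n)\<close> must hit \<open>C\<close> with frequency less than \<open>q\<close>.\<close>

section \<open>Recursive functions, decidable and semidecidable predicates\<close>

definition proj1 :: "nat \<Rightarrow> nat" where "proj1 n = fst (prod_decode n)"
definition proj2 :: "nat \<Rightarrow> nat" where "proj2 n = snd (prod_decode n)"

lemma proj1_pair [simp]: "proj1 (prod_encode (a, b)) = a" by (simp add: proj1_def)
lemma proj2_pair [simp]: "proj2 (prod_encode (a, b)) = b" by (simp add: proj2_def)
lemma pair_proj1_proj2 [simp]: "prod_encode (proj1 n, proj2 n) = n" by (simp add: proj1_def proj2_def)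

definition total_rec :: "(nat \<Rightarrow> nat) \<Rightarrow> bool" where
  "total_rec f \<longleftrightarrow> partrec (\<lambda>n. Some (f n))"

definition decidable :: "(nat \<Rightarrow> bool) \<Rightarrow> bool" where
  "decidable P \<longleftrightarrow> total_rec (\<lambda>n. of_bool (P n))"

text \<open>A projection of a decidable relation rather than the domain of a partial recursive
  function: closure properties then only rearrange existential witnesses. The link to partial
  recursive functions is \<open>partrec_graph\<close>.\<close>

definition semidec :: "(nat \<Rightarrow> bool) \<Rightarrow> bool" where
  "semidec P \<longleftrightarrow> (\<exists>Q. decidable (\<lambda>z. Q (proj1 z) (proj2 z)) \<and> (\<forall>x. P x \<longleftrightarrow> (\<exists>s. Q x s)))"

section \<open>Closure properties of total recursive functions and decidable relations\<close>

named_theorems rec_intros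

lemma total_rec_comp: "total_rec f \<Longrightarrow> total_rec g \<Longrightarrow> total_rec (\<lambda>x. f (g x))"
  unfolding total_rec_def using partrec.comp[of "\<lambda>n. Some (f n)" "\<lambda>n. Some (g n)"] by simp

lemma total_rec_pair [rec_intros]: "total_rec f \<Longrightarrow> total_rec g \<Longrightarrow>
    total_rec (\<lambda>x. prod_encode (f x, g x))"
  unfolding total_rec_def using partrec.pair[of "\<lambda>n. Some (f n)" "\<lambda>n. Some (g n)"] by simp

lemma total_rec_proj1_fun: "total_rec proj1" unfolding total_rec_def proj1_def by (rule partrec.left)
lemma total_rec_proj2_fun: "total_rec proj2" unfolding total_rec_def proj2_def by (rule partrec.right)
lemma total_rec_Suc_fun: "total_rec Suc" unfolding total_rec_def by (rule partrec.succ)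

lemmas total_rec_proj1 [rec_intros] = total_rec_comp[OF total_rec_proj1_fun]
lemmas total_rec_proj2 [rec_intros] = total_rec_comp[OF total_rec_proj2_fun]
lemmas total_rec_Suc [rec_intros] = total_rec_comp[OF total_rec_Suc_fun]

lemma total_rec_id [rec_intros]: "total_rec (\<lambda>x. x)"
  using total_rec_pair[OF total_rec_proj1_fun total_rec_proj2_fun] by simp

lemma total_rec_const [rec_intros]: "total_rec (\<lambda>x. c)"
proof (induction c)
  case 0 show ?case unfolding total_rec_def by (rule partrec.zero)
next
  case (Suc c) then show ?case by (rule total_rec_Suc)
qed

lemma total_rec_comp2:
  assumes "total_rec (\<lambda>z. h (proj1 z) (proj2 z))" "total_rec f" "total_rec g"
  shows "total_rec (\<lambda>x. h (f x) (g x))"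
  using total_rec_comp[OF assms(1) total_rec_pair[OF assms(2,3)]] by simp

lemma total_rec_rec [rec_intros]:
  assumes "total_rec b" "total_rec a" "total_rec (\<lambda>z. g (proj1 z) (proj1 (proj2 z)) (proj2
      (proj2 z)))"
  shows "total_rec (\<lambda>x. rec_nat (a x) (\<lambda>y r. g x y r) (b x))"
proof -
  let ?G = "\<lambda>z. g (proj1 z) (proj1 (proj2 z)) (proj2 (proj2 z))"
  have eq: "rec_nat (Some c) (\<lambda>y r. Option.bind r (\<lambda>i. Some (h y i))) k = Some (rec_nat c h k)"
    for c :: nat and h k by (induction k) auto
  have "partrec (\<lambda>n. rec_nat (Some (a (proj1 n)))
      (\<lambda>y r. Option.bind r (\<lambda>i. Some (?G (prod_encode (proj1 n, prod_encode (y, i)))))) (proj2 n))"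
    using partrec.prec[of "\<lambda>n. Some (a n)" "\<lambda>n. Some (?G n)"] assms(2,3)
    unfolding total_rec_def proj1_def[symmetric] proj2_def[symmetric] by blast
  then have "total_rec (\<lambda>n. rec_nat (a (proj1 n)) (\<lambda>y r. g (proj1 n) y r) (proj2 n))"
    unfolding total_rec_def eq by simp
  from total_rec_comp[OF this total_rec_pair[OF total_rec_id assms(1)]] show ?thesis by simp
qed

lemma total_rec_funpow [rec_intros]:
  assumes "total_rec n" "total_rec a" "total_rec h"
  shows "total_rec (\<lambda>x. (h ^^ n x) (a x))"
proof -
  have "(h ^^ k) c = rec_nat c (\<lambda>_ r. h r) k" for k c by (induction k) auto
  then show ?thesis
    using total_rec_rec[OF assms(1,2), of "\<lambda>_ _ r. h r"] total_rec_comp[OF assms(3)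
        total_rec_proj2[OF total_rec_proj2[OF total_rec_id]]] by simp
qed

lemma total_rec_pred [rec_intros]: "total_rec f \<Longrightarrow> total_rec (\<lambda>x. f x - 1)"
proof -
  assume f: "total_rec f"
  have "n - 1 = rec_nat 0 (\<lambda>y _. y) n" for n :: nat by (cases n) auto
  then show ?thesis by (simp only:) (intro rec_intros f)
qed

lemma total_rec_add [rec_intros]:
  assumes "total_rec f" "total_rec g" shows "total_rec (\<lambda>x. f x + g x)"
proof -
  have "a + b = rec_nat a (\<lambda>_ r. Suc r) b" for a b :: nat by (induction b) auto
  then show ?thesis by (simp only:) (intro rec_intros assms)
qed

lemma total_rec_mult [rec_intros]:
  assumes "total_rec f" "total_rec g" shows "total_rec (\<lambda>x. f x * g x)"
proof -
  have "a * b = rec_nat 0 (\<lambda>_ r. r + a) b" for a b :: nat by (induction b) auto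
  then show ?thesis by (simp only:) (intro rec_intros assms assms[THEN total_rec_comp])
qed

lemma total_rec_power [rec_intros]:
  assumes "total_rec f" "total_rec g" shows "total_rec (\<lambda>x. f x ^ g x)"
proof -
  have "a ^ b = rec_nat 1 (\<lambda>_ r. r * a) b" for a b :: nat by (induction b) auto
  then show ?thesis by (simp only:) (intro rec_intros assms assms[THEN total_rec_comp])
qed

lemma total_rec_diff [rec_intros]:
  assumes "total_rec f" "total_rec g" shows "total_rec (\<lambda>x. f x - g x)"
proof -
  have eq: "a - b = rec_nat a (\<lambda>_ r. r - 1) b" for a b :: nat by (induction b) auto
  show ?thesis by (subst eq) (intro rec_intros assms)
qed

lemma total_rec_sum [rec_intros]:
  assumes "total_rec n" "total_rec (\<lambda>z. h (proj1 z) (proj2 z))"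
  shows "total_rec (\<lambda>x. \<Sum>i<n x. h x i)"
proof -
  have "(\<Sum>i<k. h x i) = rec_nat 0 (\<lambda>y r. r + h x y) k" for x k by (induction k) auto
  then show ?thesis by (simp only:) (intro rec_intros assms total_rec_comp2[OF assms(2)])
qed

lemma total_rec_of_bool [rec_intros]: "decidable P \<Longrightarrow> total_rec (\<lambda>x. of_bool (P x))"
  by (simp add: decidable_def)

lemma decidable_comp: "decidable P \<Longrightarrow> total_rec f \<Longrightarrow> decidable (\<lambda>x. P (f x))"
  unfolding decidable_def by (rule total_rec_comp)

lemma decidable_comp2:
  "decidable (\<lambda>z. P (proj1 z) (proj2 z)) \<Longrightarrow> total_rec f \<Longrightarrow> total_rec g \<Longrightarrow> decidable (\<lambda>x. P (f x) (g x))"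
  unfolding decidable_def by (rule total_rec_comp2)

lemma decidable_is0 [rec_intros]: "total_rec f \<Longrightarrow> decidable (\<lambda>x. f x = 0)"
proof -
  assume f: "total_rec f"
  have "of_bool (n = 0) = 1 - n" for n :: nat by (cases n) auto
  then show ?thesis unfolding decidable_def by (simp only:) (intro rec_intros f)
qed

lemma decidable_not [rec_intros]: "decidable P \<Longrightarrow> decidable (\<lambda>x. \<not> P x)"
proof -
  assume P: "decidable P"
  have "of_bool (\<not> p) = (1 :: nat) - of_bool p" for p by (cases p) auto
  then show ?thesis unfolding decidable_def by (simp only:) (intro rec_intros P)
qed

lemma decidable_conj [rec_intros]: "decidable P \<Longrightarrow> decidable Q \<Longrightarrow> decidable (\<lambda>x. P x \<and> Q x)"
proof -
  assume P: "decidable P" "decidable Q"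
  have eq: "of_bool (p \<and> q) = (of_bool p * of_bool q :: nat)" for p q by (cases p) auto
  show ?thesis unfolding decidable_def by (subst eq) (intro rec_intros P)
qed

lemma decidable_disj [rec_intros]: assumes "decidable P" "decidable Q" shows "decidable
    (\<lambda>x. P x \<or> Q x)"
proof -
  have "decidable (\<lambda>x. \<not> (\<not> P x \<and> \<not> Q x))" by (intro rec_intros assms)
  then show ?thesis by simp
qed

lemma decidable_imp [rec_intros]: assumes "decidable P" "decidable Q" shows "decidable
    (\<lambda>x. P x \<longrightarrow> Q x)"
proof -
  have "decidable (\<lambda>x. \<not> P x \<or> Q x)" by (intro rec_intros assms)
  then show ?thesis by simp
qed

lemma decidable_le [rec_intros]: assumes "total_rec f" "total_rec g" shows "decidable (\<lambda>x. f x \<le> g x)"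
proof -
  have "decidable (\<lambda>x. f x - g x = 0)" by (intro decidable_is0 total_rec_diff assms)
  then show ?thesis by simp
qed

lemma decidable_less [rec_intros]: assumes "total_rec f" "total_rec g" shows "decidable
    (\<lambda>x. f x < g x)"
proof -
  have "decidable (\<lambda>x. \<not> g x \<le> f x)" by (intro rec_intros assms)
  then show ?thesis by (simp add: not_le)
qed

lemma decidable_eq [rec_intros]: assumes "total_rec f" "total_rec g" shows "decidable (\<lambda>x. f x = g x)"
proof -
  have "decidable (\<lambda>x. f x \<le> g x \<and> g x \<le> f x)" by (intro decidable_conj decidable_le assms)
  then show ?thesis by (simp only: order_eq_iff)
qed

lemma decidable_all_less [rec_intros]:
  assumes "total_rec n" "decidable (\<lambda>z. P (proj1 z) (proj2 z))"
  shows "decidable (\<lambda>x. \<forall>i<n x. P x i)"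
proof -
  have eq: "(\<forall>i<k. Q i) \<longleftrightarrow> (\<Sum>i<k. of_bool (\<not> Q i)) = (0::nat)" for k :: nat and Q
    by auto
  show ?thesis unfolding eq by (intro rec_intros assms)
qed

lemma decidable_all_le [rec_intros]:
  assumes "total_rec n" "decidable (\<lambda>z. P (proj1 z) (proj2 z))"
  shows "decidable (\<lambda>x. \<forall>i\<le>n x. P x i)"
  using decidable_all_less[OF total_rec_Suc[OF assms(1)] assms(2)] by (simp add: less_Suc_eq_le)

lemma decidable_ex_less [rec_intros]:
  assumes "total_rec n" "decidable (\<lambda>z. P (proj1 z) (proj2 z))"
  shows "decidable (\<lambda>x. \<exists>i<n x. P x i)"
  using decidable_not[OF decidable_all_less[OF assms(1) decidable_not[OF assms(2)]]] by simp

lemma decidable_ex_le [rec_intros]: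
  assumes "total_rec n" "decidable (\<lambda>z. P (proj1 z) (proj2 z))"
  shows "decidable (\<lambda>x. \<exists>i\<le>n x. P x i)"
  using decidable_not[OF decidable_all_le[OF assms(1) decidable_not[OF assms(2)]]] by simp

lemma total_rec_if [rec_intros]:
  assumes "decidable P" "total_rec f" "total_rec g" shows "total_rec (\<lambda>x. if P x then f x else g x)"
proof -
  have "(if p then a else b) = of_bool p * a + of_bool (\<not> p) * b" for p and a b :: nat by simp
  then show ?thesis by (simp only:) (intro rec_intros assms)
qed

lemma partrec_search:
  assumes "decidable (\<lambda>z. P (proj1 z) (proj2 z))"
  shows "partrec (\<lambda>x. if \<exists>y. P x y then Some (LEAST y. P x y) else None)"
proof -
  have "total_rec (\<lambda>z. of_bool (\<not> P (proj1 z) (proj2 z)))" by (intro rec_intros assms)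
  from partrec.minim[OF this[unfolded total_rec_def]] show ?thesis
    by (simp cong: if_cong)
qed

lemma total_rec_Least [rec_intros]:
  assumes "decidable (\<lambda>z. P (proj1 z) (proj2 z))" "\<And>x. \<exists>y. P x y"
  shows "total_rec (\<lambda>x. LEAST y. P x y)"
  using partrec_search[OF assms(1)] assms(2) by (simp add: total_rec_def)

lemma total_rec_div [rec_intros]:
  assumes "total_rec f" "total_rec g" shows "total_rec (\<lambda>x. f x div g x)"
proof -
  \<comment> \<open>The disjunct \<open>b = 0\<close> keeps the search total and yields 0, the value
    of \<open>a div 0\<close>.\<close>
  have eq: "a div b = (LEAST q. b = 0 \<or> a < Suc q * b)" for a b :: nat
  proof (cases "b = 0")
    case False
    have "a < Suc (a div b) * b"
      using False by (metis dividend_less_div_times mult_Suc neq0_conv)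
    moreover have "a div b \<le> q" if "a < Suc q * b" for q
      using that False less_mult_imp_div_less by (metis less_Suc_eq_le)
    ultimately show ?thesis using False by (intro Least_equality[symmetric]) auto
  qed simp
  have ex: "\<exists>q. g x = 0 \<or> f x < Suc q * g x" for x
    by (metis dividend_less_div_times mult_Suc neq0_conv)
  show ?thesis unfolding eq
    by (intro total_rec_Least ex) (intro rec_intros assms assms[THEN total_rec_comp])
qed

lemma total_rec_mod [rec_intros]: "total_rec f \<Longrightarrow> total_rec g \<Longrightarrow> total_rec (\<lambda>x. f x mod g x)"
  unfolding modulo_nat_def by (intro rec_intros)

lemma decidable_even [rec_intros]: "total_rec f \<Longrightarrow> decidable (\<lambda>x. even (f x))"
  unfolding even_iff_mod_2_eq_zero by (intro rec_intros)

lemma decidable_bit [rec_intros]: "total_rec f \<Longrightarrow> total_rec g \<Longrightarrow> decidable (\<lambda>x. bit (f x) (g x))"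
  unfolding bit_iff_odd by (intro rec_intros)

text \<open>A number is read as an iterated pair, hence as an infinite sequence without a stored
  length. Decoding is total, and every finite sequence is an initial part of some decoded
  one.\<close>

definition seq_nth :: "nat \<Rightarrow> nat \<Rightarrow> nat" where
  "seq_nth c i = proj1 ((proj2 ^^ i) c)"

lemma total_rec_seq_nth [rec_intros]: "total_rec f \<Longrightarrow> total_rec g \<Longrightarrow>
    total_rec (\<lambda>x. seq_nth (f x) (g x))"
  unfolding seq_nth_def by (intro rec_intros total_rec_proj2_fun)

lemma seq_nth_exists: "\<exists>c. \<forall>i<n. seq_nth c i = a i"
proof (induction n arbitrary: a)
  case (Suc n)
  from Suc.IH[of "\<lambda>i. a (Suc i)"] obtain c where c: "\<forall>i<n. seq_nth c i = a (Suc i)" by blast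
  have "seq_nth (prod_encode (a 0, c)) i = a i" if "i < Suc n" for i
    using that c by (cases i) (simp_all add: seq_nth_def funpow_Suc_right del: funpow.simps(2))
  then show ?case by blast
qed simp

section \<open>Closure properties of semidecidable predicates; graphs of partial recursive
  functions\<close>

named_theorems semidec_intros

lemma decidable_semidec: "decidable P \<Longrightarrow> semidec P"
  unfolding semidec_def by (rule exI[of _ "\<lambda>x s. P x"])
      (auto intro: decidable_comp total_rec_proj1_fun)

lemma semidec_comp: "semidec P \<Longrightarrow> total_rec f \<Longrightarrow> semidec (\<lambda>x. P (f x))"
proof -
  assume "semidec P" and f: "total_rec f"
  then obtain Q where Q: "decidable (\<lambda>z. Q (proj1 z) (proj2 z))" "\<And>x. P x \<longleftrightarrow> (\<exists>s. Q x s)"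
    unfolding semidec_def by blast
  show ?thesis unfolding semidec_def Q(2)
    by (intro exI[of _ "\<lambda>x s. Q (f x) s"] conjI decidable_comp2[OF Q(1)] rec_intros
        total_rec_comp[OF f]) auto
qed

lemma semidec_comp2:
  assumes "semidec (\<lambda>z. P (proj1 z) (proj2 z))" "total_rec f" "total_rec g" shows "semidec (\<lambda>x. P
      (f x) (g x))"
  using semidec_comp[OF assms(1) total_rec_pair[OF assms(2,3)]] by simp

lemma semidec_ex [semidec_intros]:
  assumes "semidec (\<lambda>z. P (proj1 z) (proj2 z))" shows "semidec (\<lambda>x. \<exists>y. P x y)"
proof -
  obtain Q where Q: "decidable (\<lambda>z. Q (proj1 z) (proj2 z))" "\<And>z. P (proj1 z) (proj2 z) \<longleftrightarrow> (\<exists>s. Q z s)"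
    using assms unfolding semidec_def by blast
  have P: "P x y \<longleftrightarrow> (\<exists>s. Q (prod_encode (x, y)) s)" for x y
    using Q(2)[of "prod_encode (x, y)"] by simp
  have "(\<exists>y. P x y) \<longleftrightarrow> (\<exists>s. Q (prod_encode (x, proj1 s)) (proj2 s))" for x
    unfolding P by (metis proj1_pair proj2_pair)
  then show ?thesis unfolding semidec_def
    by (intro exI[of _ "\<lambda>x s. Q (prod_encode (x, proj1 s))
        (proj2 s)"] conjI decidable_comp2[OF Q(1)] rec_intros)
       simp
qed

lemma semidec_conj [semidec_intros]:
  assumes "semidec P" "semidec R" shows "semidec (\<lambda>x. P x \<and> R x)"
proof -
  obtain Q where Q: "decidable (\<lambda>z. Q (proj1 z) (proj2 z))" "\<And>x. P x \<longleftrightarrow> (\<exists>s. Q x s)"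
    using assms unfolding semidec_def by blast
  obtain S where S: "decidable (\<lambda>z. S (proj1 z) (proj2 z))" "\<And>x. R x \<longleftrightarrow> (\<exists>s. S x s)"
    using assms unfolding semidec_def by blast
  have "decidable (\<lambda>z. Q (proj1 z) (proj1 (proj2 z)) \<and> S (proj1 z) (proj2 (proj2 z)))"
    by (intro rec_intros decidable_comp2[OF Q(1)] decidable_comp2[OF S(1)])
  then have "semidec (\<lambda>x. \<exists>s. Q x (proj1 s) \<and> S x (proj2 s))"
    by (intro semidec_ex decidable_semidec)
  moreover have "(\<exists>s. Q x (proj1 s) \<and> S x (proj2 s)) \<longleftrightarrow> P x \<and> R x" for x
    unfolding Q S by (metis proj1_pair proj2_pair)
  ultimately show ?thesis by simp
qed

lemma semidec_disj [semidec_intros]: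
  assumes "semidec P" "semidec R" shows "semidec (\<lambda>x. P x \<or> R x)"
proof -
  obtain Q where Q: "decidable (\<lambda>z. Q (proj1 z) (proj2 z))" "\<And>x. P x \<longleftrightarrow> (\<exists>s. Q x s)"
    using assms unfolding semidec_def by blast
  obtain S where S: "decidable (\<lambda>z. S (proj1 z) (proj2 z))" "\<And>x. R x \<longleftrightarrow> (\<exists>s. S x s)"
    using assms unfolding semidec_def by blast
  have "decidable (\<lambda>z. Q (proj1 z) (proj2 z) \<or> S (proj1 z) (proj2 z))"
    by (intro rec_intros Q S)
  then have "semidec (\<lambda>x. \<exists>s. Q x s \<or> S x s)"
    by (intro semidec_ex decidable_semidec)
  then show ?thesis unfolding Q S by (simp add: ex_disj_distrib)
qed

text \<open>The witnesses for the finitely many \<open>i < n x\<close> are collected into one number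
  by \<open>seq_nth\<close>, which moves the existential quantifier in front of the bounded
  one.\<close>

lemma semidec_all_less [semidec_intros]:
  assumes "total_rec n" "semidec (\<lambda>z. P (proj1 z) (proj2 z))" shows "semidec (\<lambda>x. \<forall>i<n x. P x i)"
proof -
  obtain Q where Q: "decidable (\<lambda>z. Q (proj1 z) (proj2 z))" "\<And>z. P (proj1 z) (proj2 z) \<longleftrightarrow> (\<exists>s. Q z s)"
    using assms unfolding semidec_def by blast
  have P: "P x y \<longleftrightarrow> (\<exists>s. Q (prod_encode (x, y)) s)" for x y
    using Q(2)[of "prod_encode (x, y)"] by simp
  have "decidable (\<lambda>z. \<forall>i<n (proj1 z). Q (prod_encode (proj1 z, i)) (seq_nth (proj2 z) i))"
    by (intro rec_intros decidable_comp2[OF Q(1)] total_rec_comp[OF assms(1)])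
  then have "semidec (\<lambda>x. \<exists>s. \<forall>i<n x. Q (prod_encode (x, i)) (seq_nth s i))"
    by (intro semidec_ex decidable_semidec)
  moreover have "(\<exists>s. \<forall>i<n x. Q (prod_encode (x, i)) (seq_nth s i)) \<longleftrightarrow> (\<forall>i<n x. P x i)" for x
  proof
    assume "\<forall>i<n x. P x i"
    then obtain a where a: "\<forall>i<n x. Q (prod_encode (x, i)) (a i)" unfolding P by metis
    obtain s where "\<forall>i<n x. seq_nth s i = a i" using seq_nth_exists by blast
    with a show "\<exists>s. \<forall>i<n x. Q (prod_encode (x, i)) (seq_nth s i)" by metis
  qed (auto simp: P)
  ultimately show ?thesis by simp
qed

text \<open>Induction on the construction of \<open>h\<close>. For primitive recursion the witness
  codes the whole sequence of intermediate values; for minimisation, a root is the least one if all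
  earlier values are defined and nonzero.\<close>

theorem partrec_graph: "partrec h \<Longrightarrow> semidec (\<lambda>z. h (proj1 z) = Some (proj2 z))"
proof (induction rule: partrec.induct)
  case zero
  then show ?case by (intro decidable_semidec) (simp, intro rec_intros)
next
  case succ
  then show ?case by (intro decidable_semidec) (simp, intro rec_intros)
next
  case left
  then show ?case unfolding proj1_def[symmetric] by (intro decidable_semidec) (simp, intro rec_intros)
next
  case right
  then show ?case unfolding proj2_def[symmetric] by (intro decidable_semidec) (simp, intro rec_intros)
next
  case (pair f g)
  have "(Option.bind (f n) (\<lambda>a. Option.bind (g n) (\<lambda>b. Some (prod_encode (a, b)))) = Some v) \<longleftrightarrow>
     f n = Some (proj1 v) \<and> g n = Some (proj2 v)" for n v
    by (auto simp: Option.bind_eq_Some_conv)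
  then show ?case
    by (simp only:) (intro semidec_intros semidec_comp2[OF pair.IH(1)] semidec_comp2[OF
        pair.IH(2)] rec_intros)
next
  case (comp f g)
  show ?case unfolding Option.bind_eq_Some_conv
    by (intro semidec_intros semidec_comp2[OF comp.IH(1)] semidec_comp2[OF comp.IH(2)] rec_intros)
next
  case (prec f g)
  define R where "R x k = rec_nat (f x) (\<lambda>y r. Option.bind r (\<lambda>i. g (prod_encode (x, prod_encode
      (y, i))))) k" for x k
  have R: "R x k = Some v \<longleftrightarrow> (\<exists>c. f x = Some (seq_nth c 0) \<and> seq_nth c k = v \<and>
       (\<forall>y<k. g (prod_encode (x, prod_encode (y, seq_nth c y))) =
           Some (seq_nth c (Suc y))))" for x k v
  proof
    assume Rk: "R x k = Some v"
    \<comment> \<open>Each stage is bound to the previous one, so definedness at \<open>k\<close>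
      passes down to all \<open>j \<le> k\<close>; the induction is on the distance
      \<open>k - j\<close>.\<close>
    have "\<exists>u. R x j = Some u" if "j \<le> k" for j
      using that Rk
    proof (induction "k - j" arbitrary: j)
      case (Suc n)
      then have "\<exists>u. R x (Suc j) = Some u" by simp
      then show ?case by (auto simp: R_def Option.bind_eq_Some_conv)
    qed simp
    then obtain a where a: "\<And>j. j \<le> k \<Longrightarrow> R x j = Some (a j)" by metis
    obtain c where c: "\<forall>i<Suc k. seq_nth c i = a i" using seq_nth_exists by blast
    have "g (prod_encode (x, prod_encode (y, a y))) = Some (a (Suc y))" if "y < k" for y
      using a[of y] a[of "Suc y"] that by (simp add: R_def)
    moreover have "f x = Some (a 0)" using a[of 0] by (simp add: R_def)
    moreover have "v = a k" using a[of k] Rk by simp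
    ultimately show "\<exists>c. f x = Some (seq_nth c 0) \<and> seq_nth c k = v \<and>
       (\<forall>y<k. g (prod_encode (x, prod_encode (y, seq_nth c y))) = Some (seq_nth c (Suc y)))"
      using c by (intro exI[of _ c]) auto
  next
    assume "\<exists>c. f x = Some (seq_nth c 0) \<and> seq_nth c k = v \<and>
       (\<forall>y<k. g (prod_encode (x, prod_encode (y, seq_nth c y))) = Some (seq_nth c (Suc y)))"
    then obtain c where c: "f x = Some (seq_nth c 0)" "seq_nth c k = v"
      "\<forall>y<k. g (prod_encode (x, prod_encode (y, seq_nth c y))) = Some (seq_nth c (Suc y))" by blast
    have "R x j = Some (seq_nth c j)" if "j \<le> k" for j
      using that by (induction j) (use c in \<open>auto simp: R_def\<close>)
    then show "R x k = Some v" using c(2) by auto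
  qed
  show ?case unfolding proj1_def[symmetric] proj2_def[symmetric] R_def[symmetric] R
    by (intro semidec_intros semidec_comp2[OF prec.IH(1)] semidec_comp2[OF prec.IH(2)] rec_intros
        decidable_semidec)
next
  case (minim f)
  have "((if \<exists>n. f (prod_encode (a, n)) = Some 0 \<and> (\<forall>k<n. f (prod_encode (a, k)) \<noteq> None)
      then Some (LEAST n. f (prod_encode (a, n)) = Some 0) else None) = Some v) \<longleftrightarrow>
      f (prod_encode (a, v)) = Some 0 \<and> (\<forall>k<v. \<exists>w. f (prod_encode (a, k)) = Some (Suc w))"
    (is "?L = _ \<longleftrightarrow> ?R") for a v
  proof
    assume L: "?L = Some v"
    then obtain n where n: "f (prod_encode (a, n)) = Some 0" "\<forall>k<n. f (prod_encode (a, k)) \<noteq> None"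
      by (auto split: if_splits)
    have v: "v = (LEAST n. f (prod_encode (a, n)) = Some 0)" using L by (auto split: if_splits)
    have "f (prod_encode (a, v)) = Some 0" unfolding v
        by (rule LeastI[of "\<lambda>n. f (prod_encode (a, n)) = Some 0", OF n(1)])
    moreover have "v \<le> n" unfolding v by (rule Least_le) (rule n)
    moreover have "f (prod_encode (a, k)) \<noteq> Some 0" if "k < v" for k
      using that not_less_Least unfolding v by blast
    ultimately show ?R using n(2) by (metis le_trans less_le_not_le linorder_not_less
        not0_implies_Suc option.exhaust)
  next
    assume R: ?R
    then have "(LEAST n. f (prod_encode (a, n)) = Some 0) = v"
      by (intro Least_equality) (auto simp: not_le[symmetric])
    then show "?L = Some v" using R by fastforce
  qed
  then show ?case
    by (simp only:) (intro semidec_intros semidec_comp2[OF minim.IH] rec_intros)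
qed

section \<open>Codes of strings, lists and rationals\<close>

text \<open>A string of length \<open>n\<close> is handled as a pair of numbers \<open>x\<close>,
  \<open>n\<close>, its entries being the lowest \<open>n\<close> binary digits of \<open>x\<close>.
  Only \<open>x mod 2 ^ n\<close> matters, so \<open>x\<close> is not unique;
  \<open>prefix_num\<close> gives the representative below \<open>2 ^ n\<close>.\<close>

definition bits :: "nat \<Rightarrow> nat \<Rightarrow> bool list" where
  "bits x n = bit x \<restriction> n"

definition prefix_num :: "(nat \<Rightarrow> bool) \<Rightarrow> nat \<Rightarrow> nat" where
  "prefix_num Z n = (\<Sum>i<n. of_bool (Z i) * 2 ^ i)"

lemma length_restr [simp]: "length (Z \<restriction> n) = n" by (simp add: restr_def)
lemma nth_restr [simp]: "i < n \<Longrightarrow> (Z \<restriction> n) ! i = Z i" by (simp add: restr_def)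

lemma restr_eq_iff: "Z \<restriction> n = Y \<restriction> n \<longleftrightarrow> (\<forall>i<n. Z i = Y i)"
  by (auto simp: restr_def)

lemma take_restr: "k \<le> n \<Longrightarrow> take k (Z \<restriction> n) = Z \<restriction> k"
  by (simp add: restr_def take_map)

lemma length_bits [simp]: "length (bits x n) = n" by (simp add: bits_def)

lemma prefix_num_horner: "prefix_num Z n = horner_sum of_bool 2 (Z \<restriction> n)"
  by (simp add: prefix_num_def horner_sum_eq_sum lessThan_atLeast0)

lemma bit_prefix_num: "i < n \<Longrightarrow> bit (prefix_num Z n) i = Z i"
  unfolding prefix_num_horner by (simp add: bit_horner_sum_bit_iff)

lemma prefix_num_less: "prefix_num Z n < 2 ^ n"
proof (induction n)
  case (Suc n)
  have "of_bool (Z n) * 2 ^ n \<le> (2 ^ n :: nat)" by simp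
  with Suc show ?case unfolding prefix_num_def by simp
qed (simp add: prefix_num_def)

lemma bits_prefix_num: "k \<le> n \<Longrightarrow> bits (prefix_num Z n) k = Z \<restriction> k"
  by (simp add: bits_def restr_eq_iff bit_prefix_num)

lemma bits_cases: obtains x where "x < 2 ^ length \<sigma>" "\<sigma> = bits x (length \<sigma>)"
proof -
  have "\<sigma> = nth \<sigma> \<restriction> length \<sigma>" by (simp add: restr_def map_nth)
  then show ?thesis using that prefix_num_less bits_prefix_num by (metis order_refl)
qed

lemma bits_eq_iff: "bits x n = bits y n \<longleftrightarrow> x mod 2 ^ n = y mod 2 ^ n"
  unfolding bits_def restr_eq_iff take_bit_eq_mod[symmetric] bit_eq_iff[of "take_bit n x"]
  by (auto simp: bit_take_bit_iff)

lemma bits_mod [simp]: "k \<le> n \<Longrightarrow> bits (x mod 2 ^ n) k = bits x k"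
  by (simp add: bits_def restr_eq_iff take_bit_eq_mod[symmetric] bit_take_bit_iff)

lemma encode_nat_id [simp]: "encode (n :: nat) = n" by (simp add: encode_nat_def)

lemma total_rec_bits [rec_intros]:
  assumes "total_rec f" "total_rec g" shows "total_rec (\<lambda>x. encode (bits (f x) (g x)))"
proof -
  \<comment> \<open>The recursion builds the list code from its end: after \<open>k\<close> steps it
    codes the last \<open>k\<close> entries.\<close>
  let ?h = "\<lambda>x n. rec_nat 0 (\<lambda>j r. Suc (prod_encode (of_bool (bit x (n - Suc j)), r)))"
  have "?h x n k = encode (map (bit x) [n - k..<n])" if "k \<le> n" for x n k
    using that
  proof (induction k)
    case (Suc k)
    then have "[n - Suc k..<n] = (n - Suc k) # [n - k..<n]"
      by (simp add: upt_conv_Cons Suc_diff_Suc)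
    with Suc show ?case by (simp add: encode_list_def encode_bool_def)
  qed (simp add: encode_list_def)
  from this[OF order_refl] have eq: "encode (bits x n) = ?h x n n" for x n
    unfolding bits_def restr_def diff_self_eq_0 by (rule sym)
  show ?thesis unfolding eq by (intro rec_intros assms assms[THEN total_rec_comp])
qed

definition code_tl :: "nat \<Rightarrow> nat" where "code_tl c = proj2 (c - 1)"
text \<open>The code of a nonempty list is the successor of the pair of its head and the code of its
  tail, and 0 codes the empty list. Searching positions below \<open>c\<close> suffices because a
  list is no longer than its code (\<open>list_encode_ge_length\<close>).\<close>

definition code_member :: "nat \<Rightarrow> nat \<Rightarrow> bool" where
  "code_member a c \<longleftrightarrow> (\<exists>i<c. (code_tl ^^ i) c \<noteq> 0 \<and> proj1 ((code_tl ^^ i) c - 1) = a)"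

lemma decidable_code_member [rec_intros]: "total_rec f \<Longrightarrow> total_rec g \<Longrightarrow>
    decidable (\<lambda>x. code_member (f x) (g x))"
proof -
  assume a: "total_rec f" "total_rec g"
  have "total_rec code_tl" unfolding code_tl_def by (intro rec_intros)
  then show ?thesis unfolding code_member_def by (intro rec_intros a a[THEN total_rec_comp])
qed

lemma list_encode_ge_length: "length xs \<le> list_encode xs"
proof (induction xs)
  case (Cons a xs)
  then show ?case using le_prod_encode_2[of "list_encode xs" a] by simp
qed simp

lemma list_encode_ge_nth: "x \<in> set xs \<Longrightarrow> x < list_encode xs"
proof (induction xs)
  case (Cons a xs)
  then show ?case using le_prod_encode_2[of "list_encode xs" a] le_prod_encode_1[of a "list_encode
      xs"] by auto
qed simp

lemma code_member_list_encode: "code_member a (list_encode xs) \<longleftrightarrow> a \<in> set xs"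
proof -
  have tl: "code_tl (list_encode ys) = list_encode (tl ys)" for ys
  proof (cases ys)
    case Nil
    \<comment> \<open>This makes 0 a fixed point of \<open>code_tl\<close>, so that iterating past
      the end stays at the empty list.\<close>
    have "prod_encode (0, 0) = 0" by (simp add: prod_encode_def)
    then have "proj2 0 = 0" by (metis proj2_pair)
    with Nil show ?thesis by (simp add: code_tl_def)
  qed (simp add: code_tl_def)
  have drop: "(code_tl ^^ i) (list_encode xs) = list_encode (drop i xs)" for i
    by (induction i) (simp_all add: tl drop_Suc tl_drop)
  have hd: "(list_encode ys \<noteq> 0 \<and> proj1 (list_encode ys - 1) = a) \<longleftrightarrow> (ys \<noteq> [] \<and> hd ys = a)" for ys
    by (cases ys) auto
  have "(\<exists>i<list_encode xs. drop i xs \<noteq> [] \<and> hd (drop i xs) = a) \<longleftrightarrow> a \<in> set xs"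
  proof
    assume "a \<in> set xs"
    then obtain i where i: "i < length xs" "xs ! i = a" by (auto simp: in_set_conv_nth)
    then show "\<exists>i<list_encode xs. drop i xs \<noteq> [] \<and> hd (drop i xs) = a"
      using list_encode_ge_length[of xs] by (intro exI[of _ i]) (auto simp: hd_drop_conv_nth)
  qed (auto simp: hd_drop_conv_nth)
  then show ?thesis unfolding code_member_def drop hd .
qed

lemma code_member_encode: "code_member c (encode xs) \<longleftrightarrow> c \<in> encode ` set xs"
  by (simp add: encode_list_def code_member_list_encode)

lemma encode_less_list: "x \<in> set xs \<Longrightarrow> encode x < encode xs"
  unfolding encode_list_def by (rule list_encode_ge_nth) simp

text \<open>The numerator of the rational coded by \<open>c\<close> is \<open>qpos c - qneg c\<close>.\<close>

definition qpos :: "nat \<Rightarrow> nat" where "qpos c = (if even (proj1 c) then proj1 c div 2 else 0)"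
definition qneg :: "nat \<Rightarrow> nat" where "qneg c = (if even (proj1 c) then 0 else Suc (proj1 c div 2))"
definition qden :: "nat \<Rightarrow> nat" where "qden c = proj2 c div 2"

lemma total_rec_rat_code [rec_intros]:
  assumes "total_rec f"
  shows "total_rec (\<lambda>x. qpos (f x))" "total_rec (\<lambda>x. qneg (f x))" "total_rec (\<lambda>x. qden (f x))"
  unfolding qpos_def qneg_def qden_def by (intro rec_intros assms)+

lemma of_rat_code:
  shows "qden (encode q) > 0"
    and "of_rat q = (real (qpos (encode q)) - real (qneg (encode q))) / real (qden (encode q))"
proof -
  obtain a b where ab: "quotient_of q = (a, b)" by fastforce
  then have b: "b > 0" by (rule quotient_of_denom_pos)
  have q: "q = of_int a / of_int b" using ab by (rule quotient_of_div)
  have c: "encode q = prod_encode (int_encode a, int_encode b)"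
    by (simp add: encode_rat_def ab encode_prod_def encode_int_def)
  have d: "qden (encode q) = nat b"
    using b by (simp add: c qden_def int_encode_def sum_encode_def)
  then show "qden (encode q) > 0" using b by simp
  have n: "real (qpos (encode q)) - real (qneg (encode q)) = of_int a"
    by (simp add: c qpos_def qneg_def int_encode_def sum_encode_def)
  show "of_rat q = (real (qpos (encode q)) - real (qneg (encode q))) / real (qden (encode q))"
    unfolding n d using b by (simp add: q of_rat_divide)
qed

text \<open>Multiplying by the positive denominator and moving the negative part to the other side
  leaves a comparison of natural numbers, which is decidable on codes.\<close>

lemma rat_le_nat: "of_rat q * real n \<le> real k \<longleftrightarrow>
    qpos (encode q) * n \<le> qden (encode q) * k + qneg (encode q) * n"
proof -
  have "of_rat q * real n \<le> real k \<longleftrightarrow>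
    (real (qpos (encode q)) - real (qneg (encode q))) * real n \<le> real (qden (encode q)) * real k"
    using of_rat_code(1)[of q] unfolding of_rat_code(2)[of q] by (simp add: field_simps)
  also have "\<dots> \<longleftrightarrow> real (qpos (encode q) * n) \<le> real (qden (encode q) * k + qneg (encode q) * n)"
    by (simp add: algebra_simps)
  finally show ?thesis by (simp only: of_nat_le_iff)
qed

lemma nat_le_rat: "real k \<le> of_rat q * real n + real l \<longleftrightarrow>
    qden (encode q) * k + qneg (encode q) * n \<le> qpos (encode q) * n + qden (encode q) * l"
proof -
  have "real k \<le> of_rat q * real n + real l \<longleftrightarrow> real (qden (encode q)) * real k \<le>
    (real (qpos (encode q)) - real (qneg (encode q))) * real n + real (qden (encode q)) * real l"
    using of_rat_code(1)[of q] unfolding of_rat_code(2)[of q] by (simp add: field_simps)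
  also have "\<dots> \<longleftrightarrow> real (qden (encode q) * k + qneg (encode q) * n) \<le>
      real (qpos (encode q) * n + qden (encode q) * l)"
    by (simp add: algebra_simps)
  finally show ?thesis by (simp only: of_nat_le_iff)
qed

section \<open>Computability on encoded types expressed through recursive functions on
  numbers\<close>

lemma total_rec_computable:
  fixes h :: "bool list \<Rightarrow> 'a::encodable"
  assumes "computable h" "total_rec f" "total_rec g" shows "total_rec (\<lambda>x. encode (h (bits (f x)
      (g x))))"
proof -
  obtain k where k: "partrec k" "\<And>x. k (encode x) = Some (encode (h x))"
    using assms(1) unfolding computable_def pcomputable_def by auto
  have "partrec (\<lambda>x. Option.bind (Some (encode (bits (f x) (g x)))) k)"
    using partrec.comp[OF k(1)] total_rec_bits[OF assms(2,3)] unfolding total_rec_def by blast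
  then show ?thesis by (simp add: total_rec_def k(2))
qed

lemma total_rec_computable_real:
  fixes Z :: "nat \<Rightarrow> bool"
  assumes "computable Z" shows "decidable Z"
proof -
  obtain k where "partrec k" "\<And>x. k (encode x) = Some (encode (Z x))"
    using assms unfolding computable_def pcomputable_def by auto
  then have "(\<lambda>x. Some (of_bool (Z x))) = k" by (auto simp: encode_bool_def)
  with \<open>partrec k\<close> show ?thesis by (simp add: decidable_def total_rec_def)
qed

lemma total_rec_prefix_num [rec_intros]: "decidable Z \<Longrightarrow> total_rec f \<Longrightarrow>
    total_rec (\<lambda>x. prefix_num Z (f x))"
proof -
  assume a: "decidable Z" "total_rec f"
  show ?thesis unfolding prefix_num_def by (intro rec_intros a decidable_comp[OF a(1)])
qed

lemma semidec_pcomputable: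
  fixes p :: "'a::encodable \<Rightarrow> 'b::encodable option"
  assumes "pcomputable p"
  shows "\<exists>G. semidec (\<lambda>z. G (proj1 z) (proj2 z)) \<and>
    (\<forall>x c. G (encode x) c \<longleftrightarrow> (\<exists>y. p x = Some y \<and> c = encode y))"
proof -
  obtain h where h: "partrec h" "\<And>x. h (encode x) = map_option encode (p x)"
    using assms unfolding pcomputable_def by blast
  show ?thesis
    by (rule exI[of _ "\<lambda>x c. h x = Some c"]) (use partrec_graph[OF h(1)] in \<open>auto simp: h(2)\<close>)
qed

lemma semidec_ce:
  fixes W :: "'a::encodable set"
  assumes "ce W"
  shows "\<exists>P. semidec P \<and> (\<forall>x. P (encode x) \<longleftrightarrow> x \<in> W)"
proof -
  obtain p :: "'a \<Rightarrow> nat option" where p: "pcomputable p" "dom p = W"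
    using assms unfolding ce_def by blast
  obtain G where G: "semidec (\<lambda>z. G (proj1 z) (proj2 z))"
    "\<And>x c. G (encode x) c \<longleftrightarrow> (\<exists>y. p x = Some y \<and> c = encode y)"
    using semidec_pcomputable[OF p(1)] by blast
  show ?thesis
    by (rule exI[of _ "\<lambda>x. \<exists>c. G x c"]) (use p(2) in \<open>auto intro: semidec_ex G(1) simp: G(2)\<close>)
qed

lemma partrec_search_then:
  assumes "decidable (\<lambda>z. Q (proj1 z) (proj2 z))" "total_rec f"
  shows "partrec (\<lambda>x. if \<exists>y. Q x y then Some (f (prod_encode (x, LEAST y. Q x y))) else None)"
proof -
  have p: "partrec (\<lambda>n. Option.bind (Some n) (\<lambda>a. Option.bind
      (if \<exists>y. Q n y then Some (LEAST y. Q n y) else None) (\<lambda>b. Some (prod_encode (a, b)))))"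
    by (rule partrec.pair[OF _ partrec_search[OF assms(1)]]) (use total_rec_id in \<open>simp add: total_rec_def\<close>)
  have f: "partrec (\<lambda>x. Some (f x))" using assms(2) by (simp add: total_rec_def)
  have "(\<lambda>x. if \<exists>y. Q x y then Some (f (prod_encode (x, LEAST y. Q x y))) else None) =
    (\<lambda>n. Option.bind (Option.bind (Some n) (\<lambda>a. Option.bind
      (if \<exists>y. Q n y then Some (LEAST y. Q n y) else None) (\<lambda>b. Some (prod_encode (a, b)))))
      (\<lambda>x. Some (f x)))" by auto
  then show ?thesis using partrec.comp[OF f p] by simp
qed

lemma ce_semidec:
  assumes "semidec P" shows "ce {x. P (encode x)}"
proof -
  obtain Q where Q: "decidable (\<lambda>z. Q (proj1 z) (proj2 z))" "\<And>x. P x \<longleftrightarrow> (\<exists>s. Q x s)"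
    using assms unfolding semidec_def by blast
  let ?p = "\<lambda>x. if \<exists>y. Q (encode x) y then Some (LEAST y. Q (encode x) y) else None"
  have "pcomputable ?p" unfolding pcomputable_def
    by (intro exI[of _ "\<lambda>x. if \<exists>y. Q x y then Some (LEAST y. Q x y) else None"] conjI
      partrec_search Q(1)) auto
  moreover have "dom ?p = {x. P (encode x)}" by (auto simp: Q(2) dom_def)
  ultimately show ?thesis unfolding ce_def by blast
qed

section \<open>Measures on Cantor space\<close>

lemma mem_cyl: "X \<in> cyl \<sigma> \<longleftrightarrow> X \<restriction> length \<sigma> = \<sigma>"
  by (simp add: cyl_def)

lemma mem_cyl_bits: "X \<in> cyl (bits x n) \<longleftrightarrow> X \<restriction> n = bits x n"
  by (simp add: cyl_def)

lemma open_cyl: "open (cyl \<sigma>)"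
proof -
  have "cyl \<sigma> = (\<Inter>i<length \<sigma>. (\<lambda>X. X i) -` {\<sigma> ! i})"
  proof -
    have "X \<restriction> length \<sigma> = \<sigma> \<longleftrightarrow> (\<forall>i<length \<sigma>. X i = \<sigma> ! i)" for X
      by (subst list_eq_iff_nth_eq) simp
    then show ?thesis by (auto simp: cyl_def)
  qed
  also have "open \<dots>"
    by (rule open_INT; (rule finite_lessThan | rule ballI, rule open_vimage,
        rule Topological_Spaces.open_discrete, rule continuous_on_product_coordinates))
  finally show ?thesis .
qed

lemma cyl_borel [measurable, simp]: "cyl \<sigma> \<in> sets borel"
  using open_cyl by (rule borel_open)

lemma open_contains_cyl:
  assumes "open S" "X \<in> S" shows "\<exists>n. cyl (X \<restriction> n) \<subseteq> S"
proof -
  from assms obtain U where U: "finite {i. U i \<noteq> UNIV}" "X \<in> Pi\<^sub>E UNIV U" "Pi\<^sub>E UNIV U \<subseteq> S"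
    using product_topology_open_contains_basis[of "\<lambda>_. euclidean" UNIV S X]
    unfolding open_fun_def by auto
  obtain n where n: "\<And>i. U i \<noteq> UNIV \<Longrightarrow> i < n"
    using finite_nat_set_iff_bounded[THEN iffD1, OF U(1)] by auto
  have "cyl (X \<restriction> n) \<subseteq> Pi\<^sub>E UNIV U"
  proof
    fix Y assume "Y \<in> cyl (X \<restriction> n)"
    then have Y: "\<And>i. i < n \<Longrightarrow> Y i = X i" by (simp add: mem_cyl restr_eq_iff)
    have "Y i \<in> U i" for i
      using n[of i] Y[of i] U(2) by (cases "U i = UNIV") (auto simp: PiE_iff)
    then show "Y \<in> Pi\<^sub>E UNIV U" by (auto simp: PiE_iff)
  qed
  then show ?thesis using U(3) by blast
qed

lemma open_Union_cyl:
  assumes "open S" shows "S = (\<Union>\<sigma>\<in>{\<sigma>. cyl \<sigma> \<subseteq> S}. cyl \<sigma>)"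
proof
  show "S \<subseteq> (\<Union>\<sigma>\<in>{\<sigma>. cyl \<sigma> \<subseteq> S}. cyl \<sigma>)"
  proof
    fix X assume "X \<in> S"
    then obtain n where "cyl (X \<restriction> n) \<subseteq> S" using open_contains_cyl[OF assms] by blast
    moreover have "X \<in> cyl (X \<restriction> n)" by (simp add: mem_cyl)
    ultimately show "X \<in> (\<Union>\<sigma>\<in>{\<sigma>. cyl \<sigma> \<subseteq> S}. cyl \<sigma>)" by blast
  qed
qed blast

text \<open>An open set is a union of cylinders, and there are only countably many strings. The
  empty set is included so that the generator becomes closed under intersection.\<close>

lemma borel_eq_sigma_cyl:
  "sets (borel :: (nat \<Rightarrow> bool) measure) = sigma_sets UNIV (insert {} (range cyl))"
proof
  show "sigma_sets UNIV (insert {} (range cyl)) \<subseteq> sets (borel :: (nat \<Rightarrow> bool) measure)"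
    by (rule borel_sigma_sets_subset) auto
  have "S \<in> sigma_sets UNIV (insert {} (range cyl))" if "open S" for S :: "(nat \<Rightarrow> bool) set"
    by (subst open_Union_cyl[OF that], rule sigma_sets_UNION) (auto intro: sigma_sets.Basic)
  then have "sigma_sets UNIV {S :: (nat \<Rightarrow> bool) set. open S} \<subseteq> sigma_sets UNIV (insert {}
      (range cyl))"
    by (intro sigma_sets_mono) blast
  then show "sets (borel :: (nat \<Rightarrow> bool) measure) \<subseteq> sigma_sets UNIV (insert {} (range cyl))"
    by (simp add: borel_def)
qed

text \<open>Two cylinders are disjoint or nested, so together with the empty set they form an
  intersection-stable generator, on which a probability measure is determined.\<close>

lemma prob_measures_eqI:
  assumes \<mu>: "\<mu> \<in> prob_measures" and \<nu>: "\<nu> \<in> prob_measures"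
    and eq: "\<And>\<sigma>. measure \<mu> (cyl \<sigma>) = measure \<nu> (cyl \<sigma>)"
  shows "\<mu> = \<nu>"
proof -
  interpret M: prob_space \<mu> using \<mu> by (simp add: prob_measures_def)
  interpret N: prob_space \<nu> using \<nu> by (simp add: prob_measures_def)
  have int: "Int_stable (insert {} (range cyl))"
  proof (rule Int_stableI)
    have c: "cyl \<sigma> \<inter> cyl \<tau> \<in> {{}, cyl \<tau>}" if "length \<sigma> \<le> length \<tau>" for \<sigma> \<tau>
    proof (cases "cyl \<sigma> \<inter> cyl \<tau> = {}")
      case False
      then obtain X where X: "X \<restriction> length \<sigma> = \<sigma>" "X \<restriction> length \<tau> = \<tau>" by (auto simp: mem_cyl)
      have "cyl \<tau> \<subseteq> cyl \<sigma>"
      proof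
        fix Y assume "Y \<in> cyl \<tau>"
        then have "Y \<restriction> length \<tau> = X \<restriction> length \<tau>" using X by (simp add: mem_cyl)
        then have "Y \<restriction> length \<sigma> = X \<restriction> length \<sigma>" using that by (simp add: restr_eq_iff)
        then show "Y \<in> cyl \<sigma>" using X by (simp add: mem_cyl)
      qed
      then show ?thesis by auto
    qed simp
    have c': "cyl \<sigma> \<inter> cyl \<tau> \<in> insert {} (range cyl)" for \<sigma> \<tau>
      using c[of \<sigma> \<tau>] c[of \<tau> \<sigma>] by (cases "length \<sigma> \<le> length \<tau>") (auto simp: Int_commute)
    fix a b :: "(nat \<Rightarrow> bool) set"
    assume "a \<in> insert {} (range cyl)" "b \<in> insert {} (range cyl)"
    then show "a \<inter> b \<in> insert {} (range cyl)"
      using c' by (elim insertE rangeE) (simp_all add: c')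
  qed
  have "cyl [] = UNIV" by (auto simp: mem_cyl restr_def)
  then show ?thesis
    using \<mu> \<nu> eq
    by (intro measure_eqI_generator_eq[OF int, where \<Omega> = UNIV and A = "\<lambda>_. UNIV"])
       (auto simp: prob_measures_def borel_eq_sigma_cyl M.emeasure_eq_measure
           N.emeasure_eq_measure intro!: image_eqI[of _ _ "[]"])
qed

lemma compact_cantor: "compact (UNIV :: (nat \<Rightarrow> bool) set)"
proof -
  have "compact_space (euclidean :: bool topology)"
    by (simp add: compact_space_def finite_imp_compact)
  then have "compact_space (product_topology (\<lambda>_::nat. euclidean :: bool topology) UNIV)"
    by (simp add: compact_space_product_topology)
  then show ?thesis
    unfolding euclidean_product_topology compact_space_def topspace_euclidean
        compactin_euclidean_iff .
qed

text \<open>Koenig's lemma as compactness: by \<open>local\<close> the sets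
  \<open>{X. P X n}\<close> are open, finitely many of them cover the space, and by
  \<open>mono\<close> the largest index serves all reals.\<close>

lemma koenig:
  assumes local: "\<And>X Y n. X \<restriction> n = Y \<restriction> n \<Longrightarrow> P X n \<Longrightarrow> P Y n"
    and mono: "\<And>X n n'. P X n \<Longrightarrow> n \<le> n' \<Longrightarrow> P X n'"
    and ex: "\<And>X. \<exists>n. P X n"
  shows "\<exists>n. \<forall>X. P X n"
proof -
  have open_P: "open {X. P X n}" for n
  proof -
    have "{X. P X n} = (\<Union>X\<in>{X. P X n}. cyl (X \<restriction> n))"
    proof
      show "(\<Union>X\<in>{X. P X n}. cyl (X \<restriction> n)) \<subseteq> {X. P X n}"
      proof
        fix Y assume "Y \<in> (\<Union>X\<in>{X. P X n}. cyl (X \<restriction> n))"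
        then obtain X where "P X n" "X \<restriction> n = Y \<restriction> n" by (auto simp: mem_cyl)
        then show "Y \<in> {X. P X n}" using local by blast
      qed
    qed (auto simp: mem_cyl)
    moreover have "open (\<Union>X\<in>{X. P X n}. cyl (X \<restriction> n))"
      by (intro open_UN ballI open_cyl)
    ultimately show ?thesis by (rule ssubst)
  qed
  have cover: "UNIV \<subseteq> (\<Union>n\<in>UNIV. {X. P X n})" using ex by auto
  obtain T where T: "finite T" "UNIV \<subseteq> (\<Union>n\<in>T. {X. P X n})"
    by (rule compactE_image[OF compact_cantor, of UNIV "\<lambda>n. {X. P X n}"])
        (rule open_P, rule cover, rule that)
  have "P X (Max T)" for X
  proof -
    obtain n where "n \<in> T" "P X n" using T(2) by blast
    then show ?thesis using mono[of X n "Max T"] T(1) by simp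
  qed
  then show ?thesis by blast
qed

text \<open>The empirical measure of the points \<open>a i\<close> for \<open>i < N\<close>, counted
  with multiplicity: the image under \<open>a\<close> of a uniform distribution.\<close>

lemma sample_measure:
  assumes "N > 0"
  shows "\<exists>\<nu>\<in>prob_measures. \<forall>S\<in>sets borel. measure \<nu> S = card {i. i < N \<and> a i \<in> S} / real N"
proof (intro bexI ballI)
  let ?\<nu> = "distr (measure_pmf (pmf_of_set {..<N})) borel a"
  show "?\<nu> \<in> prob_measures"
    by (auto simp: prob_measures_def intro!: measure_pmf.prob_space_distr)
  fix S :: "(nat \<Rightarrow> bool) set" assume S: "S \<in> sets borel"
  have "{..<N} \<noteq> {}" using assms by auto
  then have "measure ?\<nu> S = card ({..<N} \<inter> a -` S) / real N"
    using S by (simp add: measure_distr measure_pmf_of_set)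
  also have "{..<N} \<inter> a -` S = {i. i < N \<and> a i \<in> S}" by auto
  finally show "measure ?\<nu> S = card {i. i < N \<and> a i \<in> S} / real N" .
qed

text \<open>A coin with bias \<open>t\<close> chooses which of the two measures is used.\<close>

lemma mix_measure:
  assumes "\<mu> \<in> prob_measures" "\<nu> \<in> prob_measures" "0 \<le> t" "t \<le> 1"
  shows "\<exists>\<kappa>\<in>prob_measures. \<forall>S\<in>sets borel. measure \<kappa> S = t * measure \<mu> S + (1 - t) * measure \<nu> S"
proof -
  define f where "f = (\<lambda>b. if b then \<mu> else \<nu>)"
  define \<kappa> where "\<kappa> = measure_pmf (bernoulli_pmf t) \<bind> f"
  interpret M: prob_space \<mu> using assms by (simp add: prob_measures_def)
  interpret N: prob_space \<nu> using assms by (simp add: prob_measures_def)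
  have fb: "prob_space (f b)" "sets (f b) = sets borel" for b
    using assms by (simp_all add: f_def prob_measures_def)
  then have "f b \<in> space (subprob_algebra borel)" for b
    by (simp add: space_subprob_algebra prob_space_imp_subprob_space)
  then have f: "f \<in> measurable (measure_pmf (bernoulli_pmf t)) (subprob_algebra borel)"
    unfolding measurable_pmf_measure1 by (rule Pi_I)
  from fb(1) have "prob_space \<kappa>"
    unfolding \<kappa>_def by (rule measure_pmf.prob_space_bind[OF AE_I2 f])
  moreover have "sets \<kappa> = sets borel"
    unfolding \<kappa>_def by (rule sets_bind) (use assms in \<open>simp_all add: f_def prob_measures_def\<close>)
  ultimately have \<kappa>: "\<kappa> \<in> prob_measures" by (simp add: prob_measures_def)
  have "measure \<kappa> S = t * measure \<mu> S + (1 - t) * measure \<nu> S" if S: "S \<in> sets borel" for S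
  proof (rule measure_eq_emeasure_eq_ennreal)
    have "emeasure \<kappa> S = (\<integral>\<^sup>+b. emeasure (f b) S \<partial>measure_pmf (bernoulli_pmf t))"
      unfolding \<kappa>_def by (rule emeasure_bind[OF _ f S]) simp
    also have "\<dots> = emeasure (f True) S * t + emeasure (f False) S * (1 - t)"
      by (rule nn_integral_bernoulli_pmf[OF assms(3,4)]) simp
    also have "\<dots> = ennreal (measure \<mu> S) * ennreal t + ennreal (measure \<nu> S) * ennreal (1 - t)"
      by (simp only: f_def if_True if_False M.emeasure_eq_measure N.emeasure_eq_measure)
    also have "\<dots> = ennreal (t * measure \<mu> S) + ennreal ((1 - t) * measure \<nu> S)"
      using assms(3,4) by (simp only: ennreal_mult' diff_ge_0_iff_ge mult.commute)
    also have "\<dots> = ennreal (t * measure \<mu> S + (1 - t) * measure \<nu> S)"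
      by (rule ennreal_plus[symmetric]; rule mult_nonneg_nonneg) (use assms(3,4) in auto)
    finally show "emeasure \<kappa> S = ennreal (t * measure \<mu> S + (1 - t) * measure \<nu> S)" .
  qed (intro add_nonneg_nonneg mult_nonneg_nonneg measure_nonneg; use assms(3,4) in simp)
  with \<kappa> show ?thesis by blast
qed

text \<open>Clopen sets are presented throughout by a predicate on the number formed by the first
  \<open>d\<close> bits; here such a set is split into its cylinders of length
  \<open>d\<close>.\<close>

lemma clopen_Un: "{X. A (prefix_num X d)} = (\<Union>x\<in>{x. x < 2 ^ d \<and> A x}. cyl (bits x d))"
proof -
  have "X \<in> cyl (bits x d) \<longleftrightarrow> prefix_num X d = x" if "x < 2 ^ d" for X x
    using that bits_eq_iff[of "prefix_num X d" d x] prefix_num_less[of X d] bits_prefix_num[of d d X]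
    by (auto simp: mem_cyl_bits)
  then show ?thesis using prefix_num_less by fastforce
qed

lemma clopen_borel: "{X. A (prefix_num X d)} \<in> sets borel"
  unfolding clopen_Un by (intro sets.finite_UN) auto

lemma disjoint_cyl: "disjoint_family_on (\<lambda>x. cyl (bits x d)) {x. x < 2 ^ d \<and> A x}"
proof -
  have "x = y" if "x < 2 ^ d" "y < 2 ^ d" "bits x d = bits y d" for x y
    using that by (simp add: bits_eq_iff)
  then show ?thesis by (auto simp: disjoint_family_on_def mem_cyl_bits)
qed

lemma measure_clopen:
  assumes "\<mu> \<in> prob_measures"
  shows "measure \<mu> {X. A (prefix_num X d)} = (\<Sum>x\<in>{x. x < 2 ^ d \<and> A x}. measure \<mu> (cyl (bits x d)))"
proof -
  interpret prob_space \<mu> using assms by (simp add: prob_measures_def)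
  show ?thesis unfolding clopen_Un
    by (rule finite_measure_finite_Union)
       (use assms disjoint_cyl in \<open>auto simp: prob_measures_def\<close>)
qed

lemma prefix_num_mod: "k \<le> n \<Longrightarrow> prefix_num X n mod 2 ^ k = prefix_num X k"
proof -
  assume "k \<le> n"
  then have "bits (prefix_num X n) k = bits (prefix_num X k) k" by (simp add: bits_prefix_num)
  then show ?thesis using prefix_num_less[of X k] by (simp add: bits_eq_iff)
qed

lemma cyl_eq_clopen: "length \<sigma> \<le> d \<Longrightarrow> cyl \<sigma> = {X. bits (prefix_num X d) (length \<sigma>) = \<sigma>}"
  by (simp add: cyl_def bits_prefix_num)

section \<open>Finite samples\<close>

text \<open>The digit at position \<open>i\<close> of \<open>w\<close> in base
  \<open>2 ^ d\<close>.\<close>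

definition sample_point :: "nat \<Rightarrow> nat \<Rightarrow> nat \<Rightarrow> nat" where
  "sample_point d w i = (w div 2 ^ (d * i)) mod 2 ^ d"

lemma sample_point_exists:
  assumes "\<And>i. a i < 2 ^ d"
  shows "\<exists>w<2 ^ (d * N). \<forall>i<N. sample_point d w i = a i"
  using assms
proof (induction N arbitrary: a)
  case (Suc N)
  from Suc.IH[of "\<lambda>i. a (Suc i)"] Suc.prems
  obtain w where w: "w < 2 ^ (d * N)" "\<And>i. i < N \<Longrightarrow> sample_point d w i = a (Suc i)" by blast
  let ?w = "a 0 + 2 ^ d * w"
  have a0: "a 0 < 2 ^ d" by (rule Suc.prems)
  have "2 ^ d * w + 2 ^ d \<le> 2 ^ d * (2 ^ (d * N) :: nat)"
    using w(1) by (metis Suc_leI add.commute mult_Suc_right mult_le_mono2)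
  then have "?w < 2 ^ (d * Suc N)" using a0 by (simp add: power_add)
  moreover have "sample_point d ?w i = a i" if "i < Suc N" for i
  proof (cases i)
    case 0
    then show ?thesis using a0 by (simp add: sample_point_def)
  next
    case (Suc j)
    have "?w div 2 ^ (d * i) = ?w div 2 ^ d div 2 ^ (d * j)"
      by (simp add: Suc power_add div_mult2_eq)
    also have "?w div 2 ^ d = w" using a0 by simp
    finally show ?thesis using w(2)[of j] that Suc by (simp add: sample_point_def)
  qed
  ultimately show ?case by blast
qed simp

text \<open>The values are laid out in consecutive blocks of the requested lengths; all positions
  left over go to the last value.\<close>

lemma exists_blocks:
  assumes "(\<Sum>x<Suc M. n x) \<le> N"
  shows "\<exists>a. (\<forall>i. a i < Suc M) \<and> (\<forall>x<Suc M. n x \<le> card {i::nat. i < N \<and> a i = x})"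
  using assms
proof (induction M arbitrary: N)
  case 0
  then show ?case by (intro exI[of _ "\<lambda>_. 0"]) simp
next
  case (Suc M)
  define K where "K = (\<Sum>x<Suc M. n x)"
  from Suc.IH[of K] obtain a where a: "\<And>i. a i < Suc M"
    "\<And>x. x < Suc M \<Longrightarrow> n x \<le> card {i. i < K \<and> a i = x}" by (auto simp: K_def)
  define b where "b i = (if i < K then a i else Suc M)" for i
  have K: "K + n (Suc M) \<le> N" using Suc.prems by (simp add: K_def)
  have "n x \<le> card {i. i < N \<and> b i = x}" if "x < Suc (Suc M)" for x
  proof (cases "x = Suc M")
    case True
    have "{K..<K + n x} \<subseteq> {i. i < N \<and> b i = x}" using K True by (auto simp: b_def)
    from card_mono[OF _ this] show ?thesis by simp
  next
    case False
    have "{i. i < K \<and> a i = x} \<subseteq> {i. i < N \<and> b i = x}" using K by (auto simp: b_def)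
    from card_mono[OF _ this] show ?thesis using a(2)[of x] that False by simp
  qed
  moreover have "b i < Suc (Suc M)" for i using a(1)[of i] by (simp add: b_def)
  ultimately show ?case by blast
qed

lemma card_split: "card {i::nat. i < N \<and> P i} + card {i. i < N \<and> \<not> P i} = N"
proof -
  have "{i. i < N \<and> P i} \<union> {i. i < N \<and> \<not> P i} = {..<N}" by auto
  moreover have "{i. i < N \<and> P i} \<inter> {i. i < N \<and> \<not> P i} = {}" by auto
  ultimately show ?thesis using card_Un_disjoint[of "{i. i < N \<and> P i}" "{i. i < N \<and> \<not> P i}"] by simp
qed

text \<open>Rounding \<open>N * \<mu>\<close> down on each of the \<open>2 ^ d\<close> cylinders of
  length \<open>d\<close> loses at most 1 per cylinder, and surplus points only increase the counts.
  This gives the lower estimate for every \<open>A\<close>; the upper one is the lower estimate for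
  the complement.\<close>

lemma exists_rounding:
  fixes N :: nat
  assumes \<mu>: "\<mu> \<in> prob_measures"
  shows "\<exists>a :: nat \<Rightarrow> nat. (\<forall>i. a i < 2 ^ d) \<and>
    (\<forall>A. \<bar>real (card {i. i < N \<and> A (a i)}) - real N * measure \<mu> {X. A (prefix_num X d)}\<bar> \<le> 2 ^ d)"
proof -
  interpret prob_space \<mu> using \<mu> by (simp add: prob_measures_def)
  have sets: "sets \<mu> = sets borel" using \<mu> by (simp add: prob_measures_def)
  then have space: "space \<mu> = UNIV" using sets_eq_imp_space_eq[OF sets] by simp
  define p where "p x = measure \<mu> (cyl (bits x d))" for x
  define n where "n x = nat \<lfloor>real N * p x\<rfloor>" for x
  have n: "real (n x) \<le> real N * p x" "real N * p x - 1 \<le> real (n x)" for x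
  proof -
    have "0 \<le> real N * p x" by (simp add: p_def)
    then have "real (n x) = of_int \<lfloor>real N * p x\<rfloor>" by (simp add: n_def)
    then show "real (n x) \<le> real N * p x" "real N * p x - 1 \<le> real (n x)" by linarith+
  qed
  have sump: "(\<Sum>x<2 ^ d. p x) = 1"
    using measure_clopen[OF \<mu>, of "\<lambda>_. True" d] prob_space
    by (simp add: p_def space lessThan_def)
  obtain M :: nat where M: "2 ^ d = Suc M" by (metis not0_implies_Suc power_not_zero zero_neq_numeral)
  have "real (\<Sum>x<2 ^ d. n x) \<le> (\<Sum>x<2 ^ d. real N * p x)"
    unfolding of_nat_sum by (intro sum_mono n)
  also have "\<dots> = real N" unfolding sum_distrib_left[symmetric] sump by simp
  finally have "(\<Sum>x<Suc M. n x) \<le> N" unfolding M of_nat_le_iff .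
  from exists_blocks[OF this] obtain a where a: "\<And>i. a i < 2 ^ d"
    "\<And>x. x < 2 ^ d \<Longrightarrow> n x \<le> card {i. i < N \<and> a i = x}" unfolding M[symmetric] by blast
  have lower: "real N * measure \<mu> {X. A (prefix_num X d)} - 2 ^ d \<le> real (card {i. i < N \<and>
      A (a i)})" for A
  proof -
    let ?T = "{x. x < 2 ^ d \<and> A x}"
    have "real N * measure \<mu> {X. A (prefix_num X d)} - 2 ^ d \<le> (\<Sum>x\<in>?T. real N * p x) - real (card ?T)"
    proof -
      have "card ?T \<le> card {..<(2::nat) ^ d}" by (rule card_mono) auto
      then have "real (card ?T) \<le> 2 ^ d" by (metis card_lessThan of_nat_le_iff of_nat_numeral
          of_nat_power)
      then show ?thesis
        by (simp add: measure_clopen[OF \<mu>] p_def sum_distrib_left)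
    qed
    also have "\<dots> = (\<Sum>x\<in>?T. real N * p x - 1)" by (simp add: sum_subtractf)
    also have "\<dots> \<le> (\<Sum>x\<in>?T. real (card {i. i < N \<and> a i = x}))"
    proof (rule sum_mono)
      fix x assume "x \<in> ?T"
      then have "real (n x) \<le> card {i. i < N \<and> a i = x}" using a(2)[of x] by simp
      then show "real N * p x - 1 \<le> real (card {i. i < N \<and> a i = x})" using n(2)[of x] by linarith
    qed
    also have "\<dots> = real (card (\<Union>x\<in>?T. {i. i < N \<and> a i = x}))"
      by (subst card_UN_disjoint) auto
    also have "(\<Union>x\<in>?T. {i. i < N \<and> a i = x}) = {i. i < N \<and> A (a i)}" using a(1) by auto
    finally show ?thesis .
  qed
  have "\<bar>real (card {i. i < N \<and> A (a i)}) - real N * measure \<mu> {X. A (prefix_num X d)}\<bar> \<le> 2 ^ d" for A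
  proof -
    have "measure \<mu> {X. \<not> A (prefix_num X d)} = 1 - measure \<mu> {X. A (prefix_num X d)}"
    proof -
      have "{X. \<not> A (prefix_num X d)} = space \<mu> - {X. A (prefix_num X d)}" by (auto simp: space)
      then show ?thesis using prob_compl[of "{X. A (prefix_num X d)}"]
          by (simp add: sets clopen_borel)
    qed
    then have "real N * measure \<mu> {X. \<not> A (prefix_num X d)} =
        real N - real N * measure \<mu> {X. A (prefix_num X d)}"
      by (simp only: right_diff_distrib mult_1_right)
    then have "real N - real N * measure \<mu> {X. A (prefix_num X d)} - 2 ^ d \<le> real (card {i. i < N \<and>
        \<not> A (a i)})"
      using lower[of "\<lambda>x. \<not> A x"] by linarith
    moreover have "real (card {i. i < N \<and> A (a i)}) + real (card {i. i < N \<and> \<not> A (a i)}) = real N"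
      using card_split[of N "\<lambda>i. A (a i)"] by linarith
    ultimately show ?thesis using lower[of A] by linarith
  qed
  with a(1) show ?thesis by blast
qed

text \<open>A number \<open>w < 2^(d * N)\<close> codes a sample of \<open>N\<close> points, each given by its first \<open>d\<close> bits. The
  constraints are relaxed by \<open>2^d / N\<close>, the error of rounding a measure to such a sample.\<close>

definition sat :: "(bool list \<times> rat \<times> rat) list \<Rightarrow> nat \<Rightarrow> nat \<Rightarrow> nat \<Rightarrow> bool" where
  "sat cs d N w \<longleftrightarrow> (\<forall>(\<sigma>, a, b)\<in>set cs. length \<sigma> \<le> d \<longrightarrow>
     of_rat a * real N \<le> real (card {i. i < N \<and> bits (sample_point d w i) (length \<sigma>) = \<sigma>} + 2 ^ d) \<and>
     real (card {i. i < N \<and> bits (sample_point d w i) (length \<sigma>) = \<sigma>}) \<le>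
         of_rat b * real N + real (2 ^ d))"

text \<open>The bound \<open>u / v\<close> on the frequency is required with a margin of
  \<open>2 ^ d / N\<close>, the rounding error, and with denominators cleared. Constraints on
  strings longer than \<open>d\<close> are skipped by \<open>sat\<close>, which only adds samples to
  be checked.\<close>

definition bounded_by ::
    "(bool list \<times> rat \<times> rat) list \<Rightarrow> (nat \<Rightarrow> bool) \<Rightarrow> nat \<Rightarrow> nat \<Rightarrow> nat \<Rightarrow> nat \<Rightarrow> bool" where
  "bounded_by cs A d N u v \<longleftrightarrow>
     (\<forall>w<2 ^ (d * N). sat cs d N w \<longrightarrow> v * (card {i. i < N \<and> A (sample_point d w i)} + 2 ^ d) < u * N)"

text \<open>Rounding \<open>\<mu>\<close> to a sample violates the constraints by at most the
  tolerance in \<open>sat\<close>, so this sample is among those checked; the margin in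
  \<open>bounded_by\<close> pays for the return from the sample to \<open>\<mu>\<close>.\<close>

lemma bounded_by_sound:
  assumes \<mu>: "\<mu> \<in> basic_open cs" and b: "bounded_by cs A d N u v" and v: "v > 0"
  shows "measure \<mu> {X. A (prefix_num X d)} < real u / real v"
proof -
  have \<mu>': "\<mu> \<in> prob_measures" using \<mu> by (simp add: basic_open_def)
  from exists_rounding[OF \<mu>', of d N] obtain a where a: "\<And>i. a i < 2 ^ d"
    "\<And>A. \<bar>real (card {i. i < N \<and> A (a i)}) - N * measure \<mu> {X. A (prefix_num X d)}\<bar> \<le> 2 ^ d" by blast
  from sample_point_exists[of a d N, OF a(1)] obtain w where w: "w < 2 ^ (d * N)" "\<And>i. i < N \<Longrightarrow>
      sample_point d w i = a i"
    by blast
  have card: "card {i. i < N \<and> A (sample_point d w i)} = card {i. i < N \<and> A (a i)}" for A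
    using w(2) by (intro arg_cong[of _ _ card]) auto
  have "sat cs d N w" unfolding sat_def
  proof (intro ballI, clarify)
    fix \<sigma> a' b' assume c: "(\<sigma>, a', b') \<in> set cs" "length \<sigma> \<le> d"
    have "of_rat a' < measure \<mu> (cyl \<sigma>)" "measure \<mu> (cyl \<sigma>) < of_rat b'"
      using \<mu> c(1) by (auto simp: basic_open_def)
    then have "of_rat a' * real N \<le> real N * measure \<mu> (cyl \<sigma>)"
      "real N * measure \<mu> (cyl \<sigma>) \<le> of_rat b' * real N"
      unfolding mult.commute[of _ "real N"] by (intro mult_left_mono; simp)+
    moreover have "\<bar>real (card {i. i < N \<and> bits (a i) (length \<sigma>) =
        \<sigma>}) - real N * measure \<mu> (cyl \<sigma>)\<bar> \<le> 2 ^ d"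
      using a(2)[of "\<lambda>x. bits x (length \<sigma>) = \<sigma>"] unfolding cyl_eq_clopen[OF c(2)] .
    ultimately show "of_rat a' * real N \<le> real (card {i. i < N \<and>
        bits (sample_point d w i) (length \<sigma>) = \<sigma>} + 2 ^ d) \<and>
     real (card {i. i < N \<and> bits (sample_point d w i) (length \<sigma>) = \<sigma>}) \<le>
         of_rat b' * real N + real (2 ^ d)"
      unfolding card[of "\<lambda>x. bits x (length \<sigma>) =
          \<sigma>"] of_nat_add of_nat_power of_nat_numeral by linarith
  qed
  with b w(1) have "v * (card {i. i < N \<and> A (sample_point d w i)} + 2 ^ d) < u * N"
    unfolding bounded_by_def by blast
  then have lt: "v * (card {i. i < N \<and> A (a i)} + 2 ^ d) < u * N"
    unfolding card[of A] .
  then have N: "N > 0" by (cases N) auto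
  have "real v * (real N * measure \<mu> {X. A (prefix_num X d)}) \<le> real v * (real (card {i. i < N \<and>
      A (a i)}) + 2 ^ d)"
    using a(2)[of A] by (intro mult_left_mono) auto
  also have "\<dots> = real (v * (card {i. i < N \<and> A (a i)} + 2 ^ d))" by simp
  also have "\<dots> < real (u * N)" using lt by (simp only: of_nat_less_iff)
  finally have "real N * (real v * measure \<mu> {X. A (prefix_num X d)}) < real N * real u"
    by (simp add: ac_simps)
  then have "real v * measure \<mu> {X. A (prefix_num X d)} < real u" using N by simp
  then show ?thesis using v by (simp add: field_simps)
qed

section \<open>The metric on measures and the completeness of the sample test\<close>

lemma measure_dist_facts:
  assumes \<mu>: "\<mu> \<in> prob_measures" and \<nu>: "\<nu> \<in> prob_measures"
  shows "measure_dist \<mu> \<nu> \<le> 2"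
    and "\<bar>measure \<mu> (cyl \<sigma>) - measure \<nu> (cyl \<sigma>)\<bar> \<le> 2 ^ length \<sigma> * measure_dist \<mu> \<nu>"
proof -
  interpret M: prob_space \<mu> using \<mu> by (simp add: prob_measures_def)
  interpret N: prob_space \<nu> using \<nu> by (simp add: prob_measures_def)
  define D where "D \<sigma> = \<bar>measure \<mu> (cyl \<sigma>) - measure \<nu> (cyl \<sigma>)\<bar>" for \<sigma>
  define m where "m n = (MAX \<sigma>\<in>{\<sigma>. length \<sigma> = n}. D \<sigma>)" for n
  have fin: "finite {\<sigma> :: bool list. length \<sigma> = n}" for n
    using finite_lists_length_eq[of "UNIV :: bool set" n] by simp
  have ne: "{\<sigma> :: bool list. length \<sigma> = n} \<noteq> {}" for n
    using length_replicate[of n True] by blast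
  have D: "0 \<le> D \<sigma>" "D \<sigma> \<le> 1" for \<sigma>
    using M.prob_le_1[of "cyl \<sigma>"] N.prob_le_1[of "cyl \<sigma>"] measure_nonneg[of \<mu> "cyl \<sigma>"]
      measure_nonneg[of \<nu> "cyl \<sigma>"] unfolding D_def by linarith+
  have Dm: "D \<sigma> \<le> m (length \<sigma>)" for \<sigma>
    unfolding m_def using fin by (intro Max_ge) auto
  have m0: "0 \<le> m n" for n
  proof -
    have "D (replicate n True) \<le> m n" using Dm[of "replicate n True"] by simp
    with D(1)[of "replicate n True"] show ?thesis by linarith
  qed
  have m1: "m n \<le> 1" for n
    unfolding m_def using fin ne D(2) by (subst Max_le_iff) auto
  have md: "measure_dist \<mu> \<nu> = (\<Sum>n. (1/2) ^ n * m n)" by (simp add: measure_dist_def m_def D_def)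
  \<comment> \<open>The terms lie between 0 and those of a geometric series with sum 2. Hence the
    series converges, and each single term is at most the distance.\<close>
  have le: "(1/2) ^ n * m n \<le> (1/2) ^ n" for n
    using m1[of n] by (intro mult_left_le) auto
  have geo: "summable (\<lambda>n. (1/2 :: real) ^ n)" by (rule summable_geometric) simp
  have sm: "summable (\<lambda>n. (1/2) ^ n * m n)"
    by (rule summable_comparison_test'[OF geo, of 0]) (use le m0 in simp)
  have "measure_dist \<mu> \<nu> \<le> (\<Sum>n. (1/2) ^ n)"
    unfolding md by (rule suminf_le[OF le sm geo])
  also have "\<dots> = 2" using suminf_geometric[of "1/2 :: real"] by simp
  finally show "measure_dist \<mu> \<nu> \<le> 2" .
  have "(1/2) ^ length \<sigma> * m (length \<sigma>) \<le> measure_dist \<mu> \<nu>"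
    unfolding md using sum_le_suminf[OF sm, of "{length \<sigma>}"] m0 by simp
  then have "m (length \<sigma>) \<le> 2 ^ length \<sigma> * measure_dist \<mu> \<nu>"
    by (simp add: power_divide field_simps)
  then show "\<bar>measure \<mu> (cyl \<sigma>) - measure \<nu> (cyl \<sigma>)\<bar> \<le> 2 ^ length \<sigma> * measure_dist \<mu> \<nu>"
    using Dm[of \<sigma>] by (simp add: D_def)
qed

text \<open>The metric is at most 2, so the supremum defining the diameter is taken over a set
  bounded above.\<close>

lemma measure_dist_le_diam:
  assumes "S \<subseteq> prob_measures" "\<mu> \<in> S" "\<nu> \<in> S"
  shows "measure_dist \<mu> \<nu> \<le> measure_diam S"
proof -
  have "bdd_above ((\<lambda>(\<mu>, \<nu>). measure_dist \<mu> \<nu>) ` (S \<times> S))"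
    using assms(1) by (intro bdd_aboveI[of _ 2]) (auto intro: measure_dist_facts(1))
  then have "(\<lambda>(\<mu>, \<nu>). measure_dist \<mu> \<nu>) (\<mu>, \<nu>) \<le> measure_diam S"
    unfolding measure_diam_def using assms(2,3) by (intro cSUP_upper) auto
  then show ?thesis by simp
qed

text \<open>Finitely many strict inequalities have a common positive slack; for the empty list 1 is
  taken.\<close>

lemma basic_open_slack:
  assumes "\<mu> \<in> basic_open cs"
  shows "\<exists>\<delta>>0. \<forall>(\<sigma>, a, b)\<in>set cs. of_rat a + \<delta> \<le> measure \<mu> (cyl \<sigma>) \<and> measure \<mu> (cyl \<sigma>) + \<delta> \<le> of_rat b"
  using assms
proof (induction cs)
  case (Cons c cs)
  obtain \<sigma> a b where c: "c = (\<sigma>, a, b)" by (cases c)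
  have "\<mu> \<in> basic_open cs" using Cons.prems by (auto simp: basic_open_def)
  with Cons.IH obtain \<delta> where \<delta>: "\<delta> > 0" "\<And>\<sigma> a b. (\<sigma>, a, b) \<in> set cs \<Longrightarrow>
      of_rat a + \<delta> \<le> measure \<mu> (cyl \<sigma>) \<and> measure \<mu> (cyl \<sigma>) + \<delta> \<le> of_rat b" by blast
  have ab: "of_rat a < measure \<mu> (cyl \<sigma>)" "measure \<mu> (cyl \<sigma>) < of_rat b"
    using Cons.prems by (auto simp: c basic_open_def)
  let ?e = "min \<delta> (min (measure \<mu> (cyl \<sigma>) - of_rat a) (of_rat b - measure \<mu> (cyl \<sigma>)))"
  have "?e > 0" using \<delta>(1) ab by simp
  moreover have "of_rat a' + ?e \<le> measure \<mu> (cyl \<tau>) \<and> measure \<mu> (cyl \<tau>) + ?e \<le> of_rat b'"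
    if "(\<tau>, a', b') \<in> set (c # cs)" for \<tau> a' b'
  proof -
    from that consider "\<tau> = \<sigma>" "a' = a" "b' = b" | "(\<tau>, a', b') \<in> set cs" by (auto simp: c)
    then show ?thesis
    proof cases
      case 2
      then show ?thesis using \<delta>(2)[OF 2] by (auto simp: min_def)
    qed (auto simp: min_def)
  qed
  ultimately show ?case by blast
qed (auto intro: exI[of _ 1])

lemma prefix_num_bit: "prefix_num (bit x) n = x mod 2 ^ n"
proof -
  have "bits (prefix_num (bit x) n) n = bits x n" by (simp add: bits_prefix_num) (simp add: bits_def)
  then show ?thesis using prefix_num_less[of "bit x" n] by (simp add: bits_eq_iff)
qed

text \<open>The set consists of at most \<open>2 ^ l\<close> cylinders of length \<open>l\<close>,
  and on each the two measures differ by at most \<open>2 ^ l\<close> times their distance.\<close>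

lemma clopen_dist:
  assumes "\<mu> \<in> prob_measures" "\<nu> \<in> prob_measures"
  shows "\<bar>measure \<mu> {X. B (prefix_num X l)} - measure \<nu> {X. B (prefix_num X l)}\<bar> \<le>
      4 ^ l * measure_dist \<mu> \<nu>"
proof -
  let ?T = "{x. x < 2 ^ l \<and> B x}"
  have d0: "0 \<le> measure_dist \<mu> \<nu>"
    using measure_dist_facts(2)[OF assms, of "[]"] by simp
  have "\<bar>measure \<mu> {X. B (prefix_num X l)} - measure \<nu> {X. B (prefix_num X l)}\<bar> =
      \<bar>\<Sum>x\<in>?T. measure \<mu> (cyl (bits x l)) - measure \<nu> (cyl (bits x l))\<bar>"
    by (simp add: measure_clopen assms sum_subtractf)
  also have "\<dots> \<le> (\<Sum>x\<in>?T. \<bar>measure \<mu> (cyl (bits x l)) - measure \<nu> (cyl (bits x l))\<bar>)"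
    by (rule sum_abs)
  also have "\<dots> \<le> (\<Sum>x\<in>?T. 2 ^ l * measure_dist \<mu> \<nu>)"
    by (intro sum_mono) (use measure_dist_facts(2)[OF assms, of "bits _ l"] in simp)
  also have "\<dots> \<le> (\<Sum>x<(2::nat) ^ l. 2 ^ l * measure_dist \<mu> \<nu>)"
    by (rule sum_mono2) (use d0 in auto)
  also have "\<dots> = 4 ^ l * measure_dist \<mu> \<nu>"
    by (simp add: power_mult_distrib[symmetric])
  finally show ?thesis .
qed

text \<open>A sample satisfying the relaxed constraints need not lie in the basic open set, but its mixture
  with a small multiple of the interior point \<open>\<mu>\<close> does, so that the diameter bounds its distance
  to \<open>\<mu>\<close>.\<close>

lemma bounded_by_complete:
  assumes \<mu>: "\<And>n. \<mu> \<in> basic_open (G n)"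
    and diam: "(\<lambda>n. measure_diam (basic_open (G n))) \<longlonglongrightarrow> 0"
    and v: "v > 0" and lt: "measure \<mu> {X. B (prefix_num X l)} < real u / real v"
  shows "\<exists>n d N. l \<le> d \<and> bounded_by (G n) (\<lambda>x. B (x mod 2 ^ l)) d N u v"
proof -
  have \<mu>': "\<mu> \<in> prob_measures" using \<mu>[of 0] by (simp add: basic_open_def)
  interpret M: prob_space \<mu> using \<mu>' by (simp add: prob_measures_def)
  define S where "S = {X. B (prefix_num X l)}"
  have S: "S \<in> sets borel" unfolding S_def by (rule clopen_borel)
  \<comment> \<open>A quarter of the gap. Passing from \<open>\<mu>\<close> to the mixture, passing
    from the mixture to the sample, and the margin in \<open>bounded_by\<close> cost at most
    \<open>\<eta>\<close> each.\<close>
  define \<eta> where "\<eta> = (real u / real v - measure \<mu> S) / 4"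
  have \<eta>: "\<eta> > 0" using lt by (simp add: \<eta>_def S_def)
  define t where "t = min \<eta> (1 / 2)"
  have t: "0 < t" "t \<le> \<eta>" "t < 1" using \<eta> by (auto simp: t_def min_def)
  have "eventually (\<lambda>n. measure_diam (basic_open (G n)) < \<eta> / 4 ^ l) sequentially"
    using diam \<eta> by (intro order_tendstoD) auto
  then obtain n where n: "measure_diam (basic_open (G n)) < \<eta> / 4 ^ l"
    by (auto simp: eventually_sequentially)
  obtain \<delta> where \<delta>: "\<delta> > 0" "\<And>\<sigma> a b. (\<sigma>, a, b) \<in> set (G n) \<Longrightarrow>
      of_rat a + \<delta> \<le> measure \<mu> (cyl \<sigma>) \<and> measure \<mu> (cyl \<sigma>) + \<delta> \<le> of_rat b"
    using basic_open_slack[OF \<mu>[of n]] by blast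
  \<comment> \<open>At least \<open>l\<close> and at least the length of every constrained string,
    so that \<open>sat\<close> skips no constraint.\<close>
  define d where "d = l + sum_list (map (length \<circ> fst) (G n))"
  have d: "length \<sigma> \<le> d" if "(\<sigma>, c) \<in> set (G n)" for \<sigma> c
    using member_le_sum_list[of "length \<sigma>" "map (length \<circ> fst) (G n)"] that
    by (force simp: d_def image_iff)
  \<comment> \<open>The sample is taken so large that the relaxation \<open>2 ^ d / N\<close> is
    smaller both than the slack \<open>t * \<delta>\<close> contributed by \<open>\<mu>\<close> to
    the mixture and than \<open>\<eta>\<close>.\<close>
  obtain N :: nat where N: "2 ^ d / min (t * \<delta>) \<eta> < real N" using reals_Archimedean2 by blast
  define \<epsilon> where "\<epsilon> = 2 ^ d / real N"
  have min0: "min (t * \<delta>) \<eta> > 0" using t \<delta> \<eta> by simp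
  then have N0: "N > 0" using N
    by (metis divide_pos_pos less_trans of_nat_0_less_iff zero_less_numeral zero_less_power)
  have "2 ^ d < real N * min (t * \<delta>) \<eta>" using N unfolding pos_divide_less_eq[OF min0] .
  then have "\<epsilon> < min (t * \<delta>) \<eta>"
    using N0 by (simp only: \<epsilon>_def pos_divide_less_eq of_nat_0_less_iff mult.commute)
  then have \<epsilon>: "\<epsilon> < t * \<delta>" "\<epsilon> < \<eta>" "0 \<le> \<epsilon>" by (auto simp: \<epsilon>_def)
  have "v * (card {i. i < N \<and> B (sample_point d w i mod 2 ^ l)} + 2 ^ d) < u * N" if w: "sat
      (G n) d N w" for w
  proof -
    obtain \<nu> where \<nu>: "\<nu> \<in> prob_measures"
      "\<And>S. S \<in> sets borel \<Longrightarrow> measure \<nu> S = card {i. i < N \<and> bit (sample_point d w i) \<in> S} / real N"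
      using sample_measure[OF N0, of "\<lambda>i. bit (sample_point d w i)"] by blast
    interpret N: prob_space \<nu> using \<nu>(1) by (simp add: prob_measures_def)
    obtain \<kappa> where \<kappa>: "\<kappa> \<in> prob_measures"
      "\<And>S. S \<in> sets borel \<Longrightarrow> measure \<kappa> S = t * measure \<mu> S + (1 - t) * measure \<nu> S"
      using mix_measure[OF \<mu>' \<nu>(1), of t] t by auto
    have "\<kappa> \<in> basic_open (G n)"
      unfolding basic_open_def
    proof (intro CollectI conjI \<kappa>(1) ballI, clarify)
      fix \<sigma> a b assume c: "(\<sigma>, a, b) \<in> set (G n)"
      have \<nu>c: "measure \<nu> (cyl \<sigma>) * real N = card {i. i < N \<and>
          bits (sample_point d w i) (length \<sigma>) = \<sigma>}"
        using \<nu>(2)[of "cyl \<sigma>"] N0 by (simp add: mem_cyl bits_def)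
      have "of_rat a * real N \<le> measure \<nu> (cyl \<sigma>) * real N + 2 ^ d"
        "measure \<nu> (cyl \<sigma>) * real N \<le> of_rat b * real N + 2 ^ d"
        using w c d[OF c] unfolding sat_def \<nu>c by fastforce+
      then have ab: "of_rat a \<le> measure \<nu> (cyl \<sigma>) + \<epsilon>" "measure \<nu> (cyl \<sigma>) \<le> of_rat b + \<epsilon>"
        using N0 by (simp_all add: \<epsilon>_def field_simps)
      have 1: "t * (of_rat a + \<delta>) \<le> t * measure \<mu> (cyl \<sigma>)" "t * measure \<mu> (cyl \<sigma>) \<le>
          t * (of_rat b - \<delta>)"
        using \<delta>(2)[OF c] t(1) by simp_all
      have 2: "(1 - t) * (of_rat a - \<epsilon>) \<le> (1 - t) * measure \<nu> (cyl \<sigma>)"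
        "(1 - t) * measure \<nu> (cyl \<sigma>) \<le> (1 - t) * (of_rat b + \<epsilon>)"
        using ab t(3) by (simp_all add: mult_left_mono)
      \<comment> \<open>The slack \<open>t * \<delta>\<close> from \<open>\<mu>\<close> thus
        outweighs the violation \<open>(1 - t) * \<epsilon>\<close> from the sample.\<close>
      have 3: "(1 - t) * \<epsilon> \<le> \<epsilon>" using \<epsilon>(3) t(1) by (simp add: algebra_simps)
      have "of_rat a < measure \<kappa> (cyl \<sigma>)"
        using 1(1) 2(1) 3 \<epsilon>(1) unfolding \<kappa>(2)[OF cyl_borel] by (simp add: algebra_simps)
      moreover have "measure \<kappa> (cyl \<sigma>) < of_rat b"
        using 1(2) 2(2) 3 \<epsilon>(1) unfolding \<kappa>(2)[OF cyl_borel] by (simp add: algebra_simps)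
      ultimately show "measure \<kappa> (cyl \<sigma>) \<in> {of_rat a<..<of_rat b}" by simp
    qed
    then have "measure_dist \<kappa> \<mu> < \<eta> / 4 ^ l"
      using measure_dist_le_diam[of "basic_open (G n)" \<kappa> \<mu>] \<mu>[of n] n by (auto simp: basic_open_def)
    then have "4 ^ l * measure_dist \<kappa> \<mu> < \<eta>" by (simp add: field_simps)
    then have "measure \<kappa> S < measure \<mu> S + \<eta>"
      using clopen_dist[OF \<kappa>(1) \<mu>', of B l] unfolding S_def by linarith
    moreover have "measure \<nu> S \<le> measure \<kappa> S + t"
    proof -
      have "t * measure \<nu> S \<le> t" using N.prob_le_1[of S] t(1) by (simp add: mult_left_le)
      moreover have "0 \<le> t * measure \<mu> S" using t(1) by simp
      ultimately show ?thesis unfolding \<kappa>(2)[OF S] by (simp add: algebra_simps)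
    qed
    ultimately have "measure \<nu> S + \<epsilon> < measure \<mu> S + 4 * \<eta>" using t(2) \<epsilon>(2) \<eta> by linarith
    also have "\<dots> = real u / real v" using v by (simp add: \<eta>_def field_simps)
    finally have "measure \<nu> S + \<epsilon> < real u / real v" .
    moreover have "measure \<nu> S = card {i. i < N \<and> B (sample_point d w i mod 2 ^ l)} / real N"
      using \<nu>(2)[OF S] by (simp add: S_def prefix_num_bit)
    ultimately have "(real (card {i. i < N \<and> B
        (sample_point d w i mod 2 ^ l)}) + 2 ^ d) / real N < real u / real v"
      by (simp add: \<epsilon>_def add_divide_distrib)
    then have "real v * (real (card {i. i < N \<and>
        B (sample_point d w i mod 2 ^ l)}) + 2 ^ d) < real u * real N"
      using v N0 by (simp add: field_simps)
    then have "real (v * (card {i. i < N \<and> B (sample_point d w i mod 2 ^ l)} + 2 ^ d)) < real (u * N)"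
      by simp
    then show ?thesis by (simp only: of_nat_less_iff)
  qed
  then have "bounded_by (G n) (\<lambda>x. B (x mod 2 ^ l)) d N u v" by (simp add: bounded_by_def)
  moreover have "l \<le> d" by (simp add: d_def)
  ultimately show ?thesis by blast
qed

section \<open>Random reals\<close>

text \<open>Syntax for the partial recursive functions. Programs are finite trees, hence countably
  many, and so there are only countably many c.e. sets and Martin-Loef tests.\<close>

datatype prog = Zero | Succ | Left | Right | Pair prog prog | Comp prog prog | Prec prog prog |
    Minim prog

instance prog :: countable by countable_datatype

primrec run :: "prog \<Rightarrow> nat \<Rightarrow> nat option" where
  "run Zero = (\<lambda>_. Some 0)"
| "run Succ = (\<lambda>n. Some (Suc n))"
| "run Left = (\<lambda>n. Some (fst (prod_decode n)))"
| "run Right = (\<lambda>n. Some (snd (prod_decode n)))"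
| "run (Pair f g) =
    (\<lambda>n. Option.bind (run f n) (\<lambda>a. Option.bind (run g n) (\<lambda>b. Some (prod_encode (a, b)))))"
| "run (Comp f g) = (\<lambda>n. Option.bind (run g n) (run f))"
| "run (Prec f g) = (\<lambda>n. rec_nat (run f (fst (prod_decode n)))
      (\<lambda>y r. Option.bind r (\<lambda>i. run g (prod_encode (fst (prod_decode n), prod_encode (y, i)))))
      (snd (prod_decode n)))"
| "run (Minim f) =
    (\<lambda>a. if \<exists>n. run f (prod_encode (a, n)) = Some 0 \<and> (\<forall>k<n. run f (prod_encode (a, k)) \<noteq> None)
      then Some (LEAST n. run f (prod_encode (a, n)) = Some 0) else None)"

lemma partrec_run: "partrec f \<Longrightarrow> \<exists>p. f = run p"
proof (induction rule: partrec.induct)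
  case zero show ?case by (rule exI[of _ Zero]) simp
next
  case succ show ?case by (rule exI[of _ Succ]) simp
next
  case left show ?case by (rule exI[of _ Left]) simp
next
  case right show ?case by (rule exI[of _ Right]) simp
next
  case (pair f g)
  then obtain p q where "f = run p" "g = run q" by blast
  then show ?case by (intro exI[of _ "Pair p q"]) simp
next
  case (comp f g)
  then obtain p q where "f = run p" "g = run q" by blast
  then show ?case by (intro exI[of _ "Comp p q"]) simp
next
  case (prec f g)
  then obtain p q where "f = run p" "g = run q" by blast
  then show ?case by (intro exI[of _ "Prec p q"]) simp
next
  case (minim f)
  then obtain p where "f = run p" by blast
  then show ?case by (intro exI[of _ "Minim p"]) (simp only: run.simps)
qed

lemma countable_ce: "countable {W :: 'a::encodable set. ce W}"
proof -
  have "{W :: 'a set. ce W} \<subseteq> range (\<lambda>p. {x. run p (encode x) \<noteq> None})"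
  proof
    fix W :: "'a set" assume "W \<in> {W. ce W}"
    then obtain p :: "'a \<Rightarrow> nat option" and h where h: "dom p = W" "partrec h"
      "\<And>x. h (encode x) = map_option encode (p x)"
      unfolding ce_def pcomputable_def by blast
    obtain q where "h = run q" using partrec_run[OF h(2)] by blast
    with h(1,3) have "W = {x. run q (encode x) \<noteq> None}" by auto
    then show "W \<in> range (\<lambda>p. {x. run p (encode x) \<noteq> None})" by blast
  qed
  then show ?thesis by (rule countable_subset) simp
qed

lemma test_level_borel: "test_level W i \<in> sets borel"
  unfolding test_level_def by (intro borel_open open_UN ballI open_cyl)

text \<open>Each test captures a null set, since the bounds on its levels tend to 0, and a countable
  union of these sets covers all nonrandom reals.\<close>

lemma nonrandom_null:
  assumes \<mu>: "\<mu> \<in> prob_measures"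
  shows "\<exists>N\<in>null_sets \<mu>. {X. \<not> ml_random \<mu> X} \<subseteq> N"
proof (rule bexI)
  interpret prob_space \<mu> using \<mu> by (simp add: prob_measures_def)
  have sets: "sets \<mu> = sets borel" using \<mu> by (simp add: prob_measures_def)
  let ?N = "\<Union>W\<in>{W. ml_test \<mu> W}. \<Inter>i. test_level W i"
  have "countable {W. ml_test \<mu> W}"
    by (rule countable_subset[OF _ countable_ce]) (auto simp: ml_test_def)
  moreover have "(\<Inter>i. test_level W i) \<in> null_sets \<mu>" if W: "ml_test \<mu> W" for W
  proof -
    have m: "(\<Inter>i. test_level W i) \<in> sets \<mu>"
      unfolding sets by (intro sets.countable_INT) (auto simp: test_level_borel)
    have "measure \<mu> (\<Inter>i. test_level W i) \<le> (1/2) ^ i" for i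
    proof -
      have "measure \<mu> (\<Inter>i. test_level W i) \<le> measure \<mu> (test_level W i)"
        by (rule finite_measure_mono) (auto simp: sets test_level_borel)
      also have "\<dots> \<le> (1/2) ^ i" using W by (simp add: ml_test_def)
      finally show ?thesis .
    qed
    moreover have "(\<lambda>i. (1/2 :: real) ^ i) \<longlonglongrightarrow> 0" by (rule LIMSEQ_power_zero) simp
    ultimately have "measure \<mu> (\<Inter>i. test_level W i) \<le> 0"
      by (intro LIMSEQ_le_const) auto
    then have "measure \<mu> (\<Inter>i. test_level W i) = 0"
      by (intro antisym measure_nonneg)
    then show ?thesis using m by (simp add: null_sets_def emeasure_eq_measure)
  qed
  ultimately show "?N \<in> null_sets \<mu>" by (intro null_sets_UN') auto
  show "{X. \<not> ml_random \<mu> X} \<subseteq> ?N" by (auto simp: ml_random_def)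
qed

lemma positive_contains_random:
  assumes \<mu>: "\<mu> \<in> prob_measures" and P: "P \<in> sets borel" "measure \<mu> P > 0"
  shows "\<exists>X\<in>P. ml_random \<mu> X"
proof (rule ccontr)
  assume "\<not> ?thesis"
  moreover obtain N where N: "N \<in> null_sets \<mu>" "{X. \<not> ml_random \<mu> X} \<subseteq> N"
    using nonrandom_null[OF \<mu>] by blast
  ultimately have "P \<subseteq> N" by blast
  moreover have "sets \<mu> = sets borel" using \<mu> by (simp add: prob_measures_def)
  ultimately have "P \<in> null_sets \<mu>" using N(1) P(1) null_sets_subset[of N \<mu> P] by simp
  then show False using P(2) by (simp add: null_sets_def measure_def)
qed

section \<open>Computable measure maps\<close>

lemma total_rec_sample_point [rec_intros]:
  "total_rec f \<Longrightarrow> total_rec g \<Longrightarrow> total_rec h \<Longrightarrow> total_rec (\<lambda>x. sample_point (f x) (g x) (h x))"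
  unfolding sample_point_def by (intro rec_intros)

lemma card_eq_sum_of_bool: "card {i. i < N \<and> P i} = (\<Sum>i<N. of_bool (P i))" for N :: nat
proof -
  have "{i. i < N \<and> P i} = {..<N} \<inter> {i. P i}" by auto
  then show ?thesis by simp
qed

text \<open>The form of \<open>sat\<close> on codes. The string of a constraint is recognised by a
  search over its length \<open>l \<le> d\<close> and its number \<open>s < 2 ^ l\<close>, so every
  quantifier is bounded and decidability follows from the closure rules.\<close>

definition sat_code :: "nat \<Rightarrow> nat \<Rightarrow> nat \<Rightarrow> nat \<Rightarrow> bool" where
  "sat_code c d N w \<longleftrightarrow> (\<forall>y<c. code_member y c \<longrightarrow> (\<forall>l\<le>d. \<forall>s<2 ^ l. proj1 y = encode (bits s l) \<longrightarrow>
     qpos (proj1 (proj2 y)) * N \<le> qden (proj1 (proj2 y)) * ((\<Sum>i<N. of_bool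
         (sample_point d w i mod 2 ^ l = s)) + 2 ^ d)
       + qneg (proj1 (proj2 y)) * N \<and>
     qden (proj2 (proj2 y)) * (\<Sum>i<N. of_bool (sample_point d w i mod 2 ^ l =
         s)) + qneg (proj2 (proj2 y)) * N
       \<le> qpos (proj2 (proj2 y)) * N + qden (proj2 (proj2 y)) * 2 ^ d))"

lemma sat_iff_code: "sat cs d N w \<longleftrightarrow> sat_code (encode cs) d N w"
proof -
  have enc: "encode (\<sigma>, a, b) = prod_encode (encode \<sigma>, prod_encode (encode a, encode b))"
    for \<sigma> :: "bool list" and a b :: rat by (simp add: encode_prod_def)
  have card: "card {i. i < N \<and> bits (sample_point d w i) l = bits s l} =
      (\<Sum>i<N. of_bool (sample_point d w i mod 2 ^ l = s))"
    if "s < 2 ^ l" for s l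
    unfolding card_eq_sum_of_bool using that by (simp add: bits_eq_iff)
  have conv: "(of_rat a * real N \<le> real (card {i. i < N \<and>
      bits (sample_point d w i) (length \<sigma>) = \<sigma>} + 2 ^ d) \<and>
      real (card {i. i < N \<and> bits (sample_point d w i) (length \<sigma>) = \<sigma>}) \<le>
          of_rat b * real N + real (2 ^ d)) \<longleftrightarrow>
    (qpos (encode a) * N \<le> qden (encode a) * ((\<Sum>i<N. of_bool (sample_point d w i mod 2 ^ length \<sigma> =
        s)) + 2 ^ d)
       + qneg (encode a) * N \<and>
     qden (encode b) * (\<Sum>i<N. of_bool (sample_point d w i mod 2 ^ length \<sigma> = s)) + qneg (encode b) * N
       \<le> qpos (encode b) * N + qden (encode b) * 2 ^ d)"
    if s: "s < 2 ^ length \<sigma>" "\<sigma> = bits s (length \<sigma>)" for \<sigma> a b s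
    unfolding rat_le_nat nat_le_rat card[OF s(1), folded s(2)] ..
  show ?thesis
  proof
    assume L: "sat cs d N w"
    show "sat_code (encode cs) d N w"
      unfolding sat_code_def
    proof (intro allI impI)
      fix y l s assume y: "code_member y (encode cs)" "l \<le>
          d" "s < 2 ^ l" "proj1 y = encode (bits s l)"
      then obtain \<sigma> a b where c: "(\<sigma>, a, b) \<in> set cs" "y = encode (\<sigma>, a, b)"
        by (auto simp: code_member_encode)
      then have \<sigma>: "\<sigma> = bits s l" using y(4) by (simp add: enc inj_eq[OF inj_encode])
      then have l: "length \<sigma> = l" by simp
      show "qpos (proj1 (proj2 y)) * N \<le> qden (proj1 (proj2 y)) * ((\<Sum>i<N. of_bool
          (sample_point d w i mod 2 ^ l = s)) + 2 ^ d)
          + qneg (proj1 (proj2 y)) * N \<and>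
        qden (proj2 (proj2 y)) * (\<Sum>i<N. of_bool (sample_point d w i mod 2 ^ l =
            s)) + qneg (proj2 (proj2 y)) * N
          \<le> qpos (proj2 (proj2 y)) * N + qden (proj2 (proj2 y)) * 2 ^ d"
        using L c y conv[of s \<sigma> a b] \<sigma> unfolding sat_def l by (auto simp: enc)
    qed
  next
    assume R: "sat_code (encode cs) d N w"
    show "sat cs d N w"
      unfolding sat_def
    proof (intro ballI, clarify)
      fix \<sigma> a b assume c: "(\<sigma>, a, b) \<in> set cs" "length \<sigma> \<le> d"
      obtain s where s: "s < 2 ^ length \<sigma>" "\<sigma> = bits s (length \<sigma>)" by (rule bits_cases)
      have "code_member (encode (\<sigma>, a, b)) (encode cs)" "encode (\<sigma>, a, b) < encode cs"
        using c(1) by (auto simp: code_member_encode intro: encode_less_list)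
      moreover have "proj1 (encode (\<sigma>, a, b)) = encode (bits s (length \<sigma>))"
        using s(2) by (simp add: enc)
      ultimately show "of_rat a * real N \<le> real (card {i. i < N \<and>
          bits (sample_point d w i) (length \<sigma>) = \<sigma>} + 2 ^ d) \<and>
        real (card {i. i < N \<and> bits (sample_point d w i) (length \<sigma>) = \<sigma>}) \<le>
            of_rat b * real N + real (2 ^ d)"
        using R c(2) s(1) unfolding conv[OF s] sat_code_def by (auto simp: enc)
    qed
  qed
qed

lemma decidable_sat_code [rec_intros]:
  assumes "total_rec c" "total_rec d" "total_rec N" "total_rec w"
  shows "decidable (\<lambda>x. sat_code (c x) (d x) (N x) (w x))"
  unfolding sat_code_def by (intro rec_intros assms assms[THEN total_rec_comp])

text \<open>\<open>Q\<close> is a decidable matrix for refuting \<open>e\<close> on a string.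
  Searching all prefixes and all witnesses up to \<open>n\<close> makes refutation decidable and,
  once it occurs along a real, permanent (\<open>stage_mono\<close>); in the limit every refutation
  is found (\<open>stage_iff\<close>).\<close>

definition stage :: "(nat \<Rightarrow> nat \<Rightarrow> bool) \<Rightarrow> nat \<Rightarrow> nat \<Rightarrow> nat \<Rightarrow> bool" where
  "stage Q e x n \<longleftrightarrow> (\<exists>j\<le>n. \<exists>s\<le>n. Q (prod_encode (e, prod_encode (x mod 2 ^ j, j))) s)"

lemma decidable_stage:
  assumes "decidable (\<lambda>z. Q (proj1 z) (proj2 z))" "total_rec e" "total_rec x" "total_rec n"
  shows "decidable (\<lambda>z. stage Q (e z) (x z) (n z))"
  unfolding stage_def
  by (intro rec_intros assms(2-) assms(2-)[THEN total_rec_comp] decidable_comp2[OF assms(1)])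

lemma stage_cong: "bits x n = bits y n \<Longrightarrow> stage Q e x n = stage Q e y n"
proof -
  assume eq: "bits x n = bits y n"
  have mod: "x mod 2 ^ j = y mod 2 ^ j" if "j \<le> n" for j
    using arg_cong[OF eq[unfolded bits_eq_iff], of "\<lambda>z. z mod 2 ^ j"] that
    by (simp add: mod_mod_cancel le_imp_power_dvd)
  show ?thesis unfolding stage_def
    by (rule ex_cong1, rule conj_cong[OF refl]) (simp only: mod)
qed

lemma stage_mono:
  assumes "stage Q e (prefix_num X n) n" "n \<le> n'"
  shows "stage Q e (prefix_num X n') n'"
proof -
  from assms(1) obtain j s where j: "j \<le> n" "s \<le>
      n" "Q (prod_encode (e, prod_encode (prefix_num X j, j))) s"
    by (auto simp: stage_def prefix_num_mod)
  then show ?thesis using assms(2) unfolding stage_def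
    by (intro exI[of _ j] conjI exI[of _ s]) (simp_all add: prefix_num_mod)
qed

lemma stage_iff:
  "(\<exists>n. stage Q e (prefix_num X n) n) \<longleftrightarrow> (\<exists>n s. Q (prod_encode (e, prod_encode
      (prefix_num X n, n))) s)"
proof
  assume "\<exists>n s. Q (prod_encode (e, prod_encode (prefix_num X n, n))) s"
  then obtain n s where "Q (prod_encode (e, prod_encode (prefix_num X n, n))) s" by blast
  then have "stage Q e (prefix_num X (max n s)) (max n s)"
    unfolding stage_def by (intro exI[of _ n] conjI exI[of _ s]) (simp_all add: prefix_num_mod)
  then show "\<exists>n. stage Q e (prefix_num X n) n" by blast
next
  assume "\<exists>n. stage Q e (prefix_num X n) n"
  then obtain n j s where "j \<le> n" "Q (prod_encode (e, prod_encode (prefix_num X n mod 2 ^ j, j))) s"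
    unfolding stage_def by blast
  then show "\<exists>n s. Q (prod_encode (e, prod_encode (prefix_num X n, n))) s"
    by (auto simp: prefix_num_mod)
qed

lemma singleton_clopen: "{X. prefix_num X l = s mod 2 ^ l} = cyl (bits s l)"
proof -
  have "prefix_num X l = s mod 2 ^ l \<longleftrightarrow> X \<restriction> l = bits s l" for X
  proof -
    have "X \<restriction> l = bits (prefix_num X l) l" by (simp add: bits_prefix_num)
    then show ?thesis using prefix_num_less[of X l] by (simp add: bits_eq_iff)
  qed
  then show ?thesis unfolding set_eq_iff mem_Collect_eq mem_cyl_bits by blast
qed

lemma ex_fraction_between:
  assumes "0 \<le> a" "a < b"
  shows "\<exists>u v :: nat. v > 0 \<and> a < real u / real v \<and> real u / real v < b"
proof -
  obtain q where q: "a < of_rat q" "of_rat q < b" using of_rat_dense[OF assms(2)] by blast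
  obtain i j where ij: "quotient_of q = (i, j)" by fastforce
  then have j: "j > 0" by (rule quotient_of_denom_pos)
  have "q = of_int i / of_int j" using ij by (rule quotient_of_div)
  then have qr: "(of_rat q :: real) = of_int i / of_int j" by (simp add: of_rat_divide)
  have "0 < (of_rat q :: real)" using q(1) assms(1) by linarith
  then have "0 < (of_int i :: real)" using j by (simp add: qr zero_less_divide_iff)
  then have "(of_rat q :: real) = real (nat i) / real (nat j)" using j qr by simp
  then show ?thesis using q j by (intro exI[of _ "nat i"] exI[of _ "nat j"]) simp
qed

lemma rat_code_upper:
  assumes "v > 0"
  shows "real u / real v + (1/2) ^ k \<le> of_rat q \<longleftrightarrow>
    qden (encode q) * (u * 2 ^ k + v) + qneg (encode q) * v * 2 ^ k \<le> qpos (encode q) * v * 2 ^ k"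
proof -
  let ?p = "real (qpos (encode q))" and ?r = "real (qneg (encode q))" and ?t =
      "real (qden (encode q))"
  have t: "?t > 0" using of_rat_code(1)[of q] by simp
  have "real u / real v + (1/2) ^ k \<le> of_rat q \<longleftrightarrow> (real u * 2 ^ k + v) / (v * 2 ^ k) \<le> (?p - ?r) / ?t"
    using assms unfolding of_rat_code(2)[of q] by (simp add: add_divide_distrib power_divide)
  also have "\<dots> \<longleftrightarrow> ?t * (u * 2 ^ k + v) \<le> (?p - ?r) * (v * 2 ^ k)"
    using assms t by (simp add: pos_divide_le_eq pos_le_divide_eq mult.commute)
  also have "\<dots> \<longleftrightarrow> real (qden (encode q) * (u * 2 ^ k + v) + qneg (encode q) * v * 2 ^ k)
      \<le> real (qpos (encode q) * v * 2 ^ k)"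
    by (simp add: algebra_simps)
  finally show ?thesis by (simp only: of_nat_le_iff)
qed

lemma rat_code_lower:
  assumes "v > 0"
  shows "of_rat q + (1/2) ^ k \<le> 1 - real u / real v \<longleftrightarrow>
    qpos (encode q) * v * 2 ^ k + qden (encode q) * (u * 2 ^ k + v)
      \<le> qden (encode q) * v * 2 ^ k + qneg (encode q) * v * 2 ^ k"
proof -
  let ?p = "real (qpos (encode q))" and ?r = "real (qneg (encode q))" and ?t =
      "real (qden (encode q))"
  have t: "?t > 0" using of_rat_code(1)[of q] by simp
  have "of_rat q + (1/2) ^ k \<le> 1 - real u / real v \<longleftrightarrow>
      (real u * 2 ^ k + v) / (v * 2 ^ k) \<le> 1 - (?p - ?r) / ?t"
    using assms unfolding of_rat_code(2)[of q] by (simp add: add_divide_distrib power_divide) linarith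
  also have "1 - (?p - ?r) / ?t = (?t - ?p + ?r) / ?t" using t by (simp add: field_simps)
  also have "(real u * 2 ^ k + v) / (v * 2 ^ k) \<le> \<dots> \<longleftrightarrow>
      ?t * (u * 2 ^ k + v) \<le> (?t - ?p + ?r) * (v * 2 ^ k)"
    using assms t by (simp add: pos_divide_le_eq pos_le_divide_eq mult.commute)
  also have "\<dots> \<longleftrightarrow> real (qpos (encode q) * v * 2 ^ k + qden (encode q) * (u * 2 ^ k + v))
      \<le> real (qden (encode q) * v * 2 ^ k + qneg (encode q) * v * 2 ^ k)"
    by (simp add: algebra_simps)
  finally show ?thesis by (simp only: of_nat_le_iff)
qed

section \<open>Semidecidable bounds on \<open>f Z\<close>, and conflicts with an index, read off
  prefixes of \<open>Z\<close>\<close>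

locale measure_map =
  fixes f :: "(nat \<Rightarrow> bool) \<Rightarrow> (nat \<Rightarrow> bool) measure"
    and F :: "bool list \<Rightarrow> (bool list \<times> rat \<times> rat) list"
    and m :: "nat \<Rightarrow> bool list \<Rightarrow> nat \<Rightarrow> rat option"
    and V :: "bool list \<Rightarrow> nat"
  assumes F_computable: "computable F"
    and F_mem: "f Z \<in> basic_open (F (Z \<restriction> n))"
    and F_diam: "(\<lambda>n. measure_diam (basic_open (F (Z \<restriction> n)))) \<longlonglongrightarrow> 0"
    and m_pcomputable: "pcomputable (\<lambda>(e, \<sigma>, k). m e \<sigma> k)"
    and V_computable: "computable V"
begin

lemma f_prob: "f Z \<in> prob_measures"
  using F_mem[of Z 0] by (simp add: basic_open_def)

lemma f_sets: "sets (f Z) = sets borel"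
  using f_prob by (simp add: prob_measures_def)

text \<open>A certificate, obtained from the prefix of \<open>Z\<close> coded by \<open>x\<close>
  and \<open>n\<close>, that a clopen set has \<open>f Z\<close>-measure less than
  \<open>u / v\<close>. Samples have \<open>d \<ge> l\<close> bits, so \<open>B\<close> is applied
  to their first \<open>l\<close> bits by reduction modulo \<open>2 ^ l\<close>.\<close>

definition below :: "nat \<Rightarrow> nat \<Rightarrow> (nat \<Rightarrow> bool) \<Rightarrow> nat \<Rightarrow> nat \<Rightarrow> nat \<Rightarrow> bool" where
  "below x n B l u v \<longleftrightarrow> v > 0 \<and>
     (\<exists>d N. l \<le> d \<and> bounded_by (F (bits x n)) (\<lambda>y. B (y mod 2 ^ l)) d N u v)"

lemma decidable_bounded_by:
  assumes B: "decidable (\<lambda>z. B (proj1 z) (proj2 z))"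
    and total_rec: "total_rec x" "total_rec n" "total_rec d" "total_rec N" "total_rec u" "total_rec v"
  shows "decidable (\<lambda>z. bounded_by (F (bits (x z) (n z))) (B z) (d z) (N z) (u z) (v z))"
  unfolding bounded_by_def sat_iff_code card_eq_sum_of_bool
  by (intro rec_intros total_rec total_rec[THEN total_rec_comp] decidable_comp2[OF B]
      total_rec_computable[OF F_computable])

lemma semidec_below:
  assumes B: "decidable (\<lambda>z. B (proj1 z) (proj2 z))" and total_rec: "total_rec x" "total_rec n"
      "total_rec l" "total_rec u" "total_rec v"
  shows "semidec (\<lambda>z. below (x z) (n z) (B z) (l z) (u z) (v z))"
  unfolding below_def
  by (intro semidec_intros decidable_semidec; intro rec_intros total_rec total_rec[THEN
      total_rec_comp] decidable_bounded_by decidable_comp2[OF B])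

lemma below_sound:
  assumes "below (prefix_num Z n) n B l u v"
  shows "measure (f Z) {X. B (prefix_num X l)} < real u / real v"
proof -
  from assms obtain d N where "l \<le> d" "v > 0"
    "bounded_by (F (Z \<restriction> n)) (\<lambda>y. B (y mod 2 ^ l)) d N u v"
    by (auto simp: below_def bits_prefix_num)
  with bounded_by_sound[OF F_mem this(3) this(2)] show ?thesis by (simp add: prefix_num_mod)
qed

lemma below_complete:
  assumes "v > 0" "measure (f Z) {X. B (prefix_num X l)} < real u / real v"
  shows "\<exists>n. below (prefix_num Z n) n B l u v"
proof -
  obtain n d N where "l \<le> d" "bounded_by (F (Z \<restriction> n)) (\<lambda>y. B (y mod 2 ^ l)) d N u v"
    using bounded_by_complete[OF F_mem F_diam assms] by blast
  then have "below (prefix_num Z n) n B l u v" using assms(1)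
      by (auto simp: below_def bits_prefix_num)
  then show ?thesis ..
qed

text \<open>One semidecidable relation agreeing with the graph of \<open>m\<close> on codes is fixed
  by choice; nothing is specified about it elsewhere.\<close>

definition m_graph :: "nat \<Rightarrow> nat \<Rightarrow> bool" where
  "m_graph = (SOME H. semidec (\<lambda>z. H (proj1 z) (proj2 z)) \<and>
    (\<forall>x c. H (encode x) c \<longleftrightarrow> (\<exists>y. (\<lambda>(e, \<sigma>, k). m e \<sigma> k) x = Some y \<and> c = encode y)))"

lemma m_graph: "semidec (\<lambda>z. m_graph (proj1 z) (proj2 z))"
  "m_graph (prod_encode (e, prod_encode (encode \<sigma>, k))) c \<longleftrightarrow> (\<exists>q. m e \<sigma> k = Some q \<and> c = encode q)"
proof -
  note * = someI_ex[OF semidec_pcomputable[OF m_pcomputable], folded m_graph_def]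
  show "semidec (\<lambda>z. m_graph (proj1 z) (proj2 z))" using * by (rule conjunct1)
  show "m_graph (prod_encode (e, prod_encode (encode \<sigma>, k))) c \<longleftrightarrow>
      (\<exists>q. m e \<sigma> k = Some q \<and> c = encode q)"
    using conjunct2[OF *, rule_format, of "(e, \<sigma>, k)" c] by (simp add: encode_prod_def)
qed

text \<open>The two numerical conditions say \<open>u / v + 2^-k \<le> q\<close> and \<open>q + 2^-k \<le> 1 - u / v\<close>, where \<open>c\<close> codes \<open>q\<close>.\<close>

definition conflict :: "nat \<Rightarrow> nat \<Rightarrow> nat \<Rightarrow> bool" where
  "conflict e x n \<longleftrightarrow> (\<exists>s l k c u v.
     m_graph (prod_encode (e, prod_encode (encode (bits s l), k))) c \<and>
     (below x n (\<lambda>y. y = s mod 2 ^ l) l u v \<and>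
        qden c * (u * 2 ^ k + v) + qneg c * v * 2 ^ k \<le> qpos c * v * 2 ^ k \<or>
      below x n (\<lambda>y. y \<noteq> s mod 2 ^ l) l u v \<and>
        qpos c * v * 2 ^ k + qden c * (u * 2 ^ k + v) \<le> qden c * v * 2 ^ k + qneg c * v * 2 ^ k))"

lemma semidec_conflict:
  assumes total_rec: "total_rec e" "total_rec x" "total_rec n"
  shows "semidec (\<lambda>z. conflict (e z) (x z) (n z))"
  unfolding conflict_def
  by (intro semidec_intros semidec_comp2[OF m_graph(1)] semidec_below rec_intros total_rec
      total_rec[THEN total_rec_comp] decidable_semidec)

text \<open>Since \<open>below\<close> certifies only upper bounds, a lower bound for a cylinder is
  certified as an upper bound for its complement.\<close>

lemma measure_compl_cyl: "measure (f Z) {X. prefix_num X l \<noteq> s mod 2 ^ l} =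
    1 - measure (f Z) (cyl (bits s l))"
proof -
  interpret prob_space "f Z" using f_prob by (simp add: prob_measures_def)
  have "space (f Z) = UNIV" using sets_eq_imp_space_eq[OF f_sets] by simp
  then have "{X. prefix_num X l \<noteq> s mod 2 ^ l} = space (f Z) - cyl (bits s l)"
    unfolding singleton_clopen[symmetric] by auto
  then show ?thesis using prob_compl[of "cyl (bits s l)"] by (simp add: f_sets)
qed

lemma conflict_sound:
  assumes "conflict e (prefix_num Z n) n" shows "\<not> measure_index m e (f Z)"
proof
  assume ind: "measure_index m e (f Z)"
  from assms obtain s l k c u v where
    graph: "m_graph (prod_encode (e, prod_encode (encode (bits s l), k))) c" and
    c: "below (prefix_num Z n) n (\<lambda>y. y = s mod 2 ^ l) l u v \<and>
        qden c * (u * 2 ^ k + v) + qneg c * v * 2 ^ k \<le> qpos c * v * 2 ^ k \<or>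
      below (prefix_num Z n) n (\<lambda>y. y \<noteq> s mod 2 ^ l) l u v \<and>
        qpos c * v * 2 ^ k + qden c * (u * 2 ^ k + v) \<le> qden c * v * 2 ^ k + qneg c * v * 2 ^ k"
    unfolding conflict_def by blast
  from graph obtain q where q: "m e (bits s l) k = Some q" "c = encode q"
      unfolding m_graph(2) by blast
  with ind have *: "\<bar>of_rat q - measure (f Z) (cyl (bits s l))\<bar> \<le> (1/2) ^ k"
    unfolding measure_index_def by (metis option.inject)
  have v: "v > 0" using c by (auto simp: below_def)
  from c show False unfolding q(2) rat_code_upper[OF v, symmetric] rat_code_lower[OF v, symmetric]
  proof (elim disjE conjE)
    assume "below (prefix_num Z n) n (\<lambda>y. y = s mod 2 ^ l) l u v"
      and le: "real u / real v + (1/2) ^ k \<le> of_rat q"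
    from below_sound[OF this(1)] have "measure (f Z) (cyl (bits s l)) < real u / real v"
      unfolding singleton_clopen .
    with le * show False by linarith
  next
    assume "below (prefix_num Z n) n (\<lambda>y. y \<noteq> s mod 2 ^ l) l u v"
      and le: "of_rat q + (1/2) ^ k \<le> 1 - real u / real v"
    from below_sound[OF this(1)] have "1 - measure (f Z) (cyl (bits s l)) < real u / real v"
      unfolding measure_compl_cyl .
    with le * show False by linarith
  qed
qed

text \<open>The excess is strict, so a fraction \<open>u / v\<close> fits between the measure of the
  cylinder, or of its complement, and the bound that \<open>q\<close> allows. Only this one value
  has to be defined: an index of a non-total measure can be refuted as well.\<close>

lemma conflict_complete:
  assumes q: "m e \<sigma> k = Some q" and far: "\<bar>of_rat q - measure (f Z) (cyl \<sigma>)\<bar> > (1/2) ^ k"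
  shows "\<exists>n. conflict e (prefix_num Z n) n"
proof -
  interpret prob_space "f Z" using f_prob by (simp add: prob_measures_def)
  obtain s where s: "\<sigma> = bits s (length \<sigma>)" by (rule bits_cases)
  define l where "l = length \<sigma>"
  have s: "\<sigma> = bits s l" using s by (simp add: l_def)
  have graph: "m_graph (prod_encode (e, prod_encode (encode (bits s l), k))) (encode q)"
    unfolding m_graph(2) using q s by simp
  from far consider "measure (f Z) (cyl \<sigma>) < of_rat q - (1/2) ^ k"
    | "1 - measure (f Z) (cyl \<sigma>) < 1 - of_rat q - (1/2) ^ k" by linarith
  then show ?thesis
  proof cases
    case 1
    from ex_fraction_between[OF measure_nonneg 1] obtain u v :: nat where uv: "v > 0"
      "measure (f Z) (cyl \<sigma>) < real u / real v" "real u / real v < of_rat q - (1/2) ^ k" by blast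
    have "measure (f Z) {X. prefix_num X l = s mod 2 ^ l} < real u / real v"
      using uv(2) unfolding singleton_clopen s .
    from below_complete[OF uv(1) this] obtain n where n: "below (prefix_num Z n) n (\<lambda>y. y =
        s mod 2 ^ l) l u v" by blast
    have "real u / real v + (1/2) ^ k \<le> of_rat q" using uv(3) by linarith
    with graph n show ?thesis unfolding conflict_def rat_code_upper[OF uv(1)] by blast
  next
    case 2
    have "0 \<le> 1 - measure (f Z) (cyl \<sigma>)" using prob_le_1 by simp
    from ex_fraction_between[OF this 2] obtain u v :: nat where uv: "v > 0"
      "1 - measure (f Z) (cyl \<sigma>) < real u / real v" "real u / real v < 1 - of_rat q -
          (1/2) ^ k" by blast
    have "measure (f Z) {X. prefix_num X l \<noteq> s mod 2 ^ l} < real u / real v"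
      using uv(2) unfolding measure_compl_cyl s .
    from below_complete[OF uv(1) this] obtain n where n: "below (prefix_num Z n) n
        (\<lambda>y. y \<noteq> s mod 2 ^ l) l u v" by blast
    have "of_rat q + (1/2) ^ k \<le> 1 - real u / real v" using uv(3) by linarith
    with graph n show ?thesis unfolding conflict_def rat_code_lower[OF uv(1)] by blast
  qed
qed

text \<open>The approximation, at length \<open>l\<close>, to the class of reals that begin with the
  \<open>h\<close> bits of \<open>a\<close> and on which \<open>V\<close> keeps the value
  \<open>e\<close> from length \<open>h\<close> on. For \<open>l \<ge> h\<close> these clopen sets
  decrease to that class.\<close>

definition settled :: "nat \<Rightarrow> nat \<Rightarrow> nat \<Rightarrow> nat \<Rightarrow> nat \<Rightarrow> bool" where
  "settled a h e l y \<longleftrightarrow> y mod 2 ^ h = a \<and> (\<forall>i\<le>l. h \<le> i \<longrightarrow> V (bits y i) = e)"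

lemma decidable_settled [rec_intros]:
  assumes total_rec: "total_rec a" "total_rec h" "total_rec e" "total_rec l" "total_rec y"
  shows "decidable (\<lambda>z. settled (a z) (h z) (e z) (l z) (y z))"
proof -
  have V: "total_rec (\<lambda>z. V (bits (p z) (q z)))" if "total_rec p" "total_rec q" for p q
    using total_rec_computable[OF V_computable that] by simp
  show ?thesis unfolding settled_def by (intro rec_intros total_rec total_rec[THEN total_rec_comp] V)
qed

lemma settled_prefix_num:
  "h \<le> l \<Longrightarrow> settled a h e l (prefix_num X l) \<longleftrightarrow> prefix_num X h = a \<and> (\<forall>i\<le>l. h \<le> i \<longrightarrow> V (X \<restriction> i) = e)"
  by (simp add: settled_def prefix_num_mod bits_prefix_num)

text \<open>If the decreasing clopen sets \<open>settled\<close> had measures with infimum zero, those that are verifiably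
  small along the computable real \<open>Z\<close> would form a Martin-Loef test capturing \<open>X\<close>.\<close>

lemma random_settled_positive:
  assumes Z: "computable Z" and X: "ml_random (f Z) X" and a: "prefix_num X h = a" "\<And>i. h \<le> i \<Longrightarrow>
      V (X \<restriction> i) = e"
  shows "\<exists>j. \<forall>l\<ge>h. (1/2) ^ j \<le> measure (f Z) {Y. settled a h e l (prefix_num Y l)}"
proof (rule ccontr)
  interpret prob_space "f Z" using f_prob by (simp add: prob_measures_def)
  define S where "S l = {Y. settled a h e l (prefix_num Y l)}" for l
  assume "\<not> ?thesis"
  then have small: "\<exists>l\<ge>h. measure (f Z) (S l) < (1/2) ^ j" for j by (auto simp: S_def not_le)
  define W where "W = {(i :: nat, \<sigma>). \<exists>y l n. \<sigma> = bits y l \<and> h \<le> l \<and> settled a h e l (y mod 2 ^ l) \<and>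
    below (prefix_num Z n) n (settled a h e l) l 1 (2 ^ i)}"
  define P where "P c \<longleftrightarrow> (\<exists>y l n. proj2 c = encode (bits y l) \<and> h \<le> l \<and> settled a h e l (y mod 2 ^ l) \<and>
    below (prefix_num Z n) n (settled a h e l) l 1 (2 ^ proj1 c))" for c
  \<comment> \<open>\<open>P\<close> is membership in \<open>W\<close> on codes; computability of
    \<open>Z\<close> lets its prefixes \<open>prefix_num Z n\<close> be produced.\<close>
  have "semidec P"
    unfolding P_def
    by (intro semidec_intros decidable_semidec semidec_below; intro rec_intros
        total_rec_computable_real[OF Z])
  then have "ce {x :: nat \<times> bool list. P (encode x)}" by (rule ce_semidec)
  moreover have "P (encode x) \<longleftrightarrow> x \<in> W" for x :: "nat \<times> bool list"
    by (cases x) (simp add: P_def W_def encode_prod_def inj_eq[OF inj_encode])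
  ultimately have ce: "ce W" by simp
  \<comment> \<open>By soundness and completeness of \<open>below\<close>, a level is the union of
    exactly those approximations whose measure is below \<open>(1/2) ^ i\<close>.\<close>
  have mem: "Y \<in> test_level W i \<longleftrightarrow> (\<exists>l\<ge>h. Y \<in> S l \<and> measure (f Z) (S l) < (1/2) ^ i)" for Y i
  proof
    assume "Y \<in> test_level W i"
    then obtain y l n where y: "Y \<restriction> l = bits y l" "h \<le> l" "settled a h e l (y mod 2 ^ l)"
      "below (prefix_num Z n) n (settled a h e l) l 1 (2 ^ i)"
          by (auto simp: test_level_def W_def mem_cyl_bits)
    have "Y \<in> {X. prefix_num X l = y mod 2 ^ l}" unfolding singleton_clopen mem_cyl_bits
        by (rule y(1))
    then have "prefix_num Y l = y mod 2 ^ l" by blast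
    then show "\<exists>l\<ge>h. Y \<in> S l \<and> measure (f Z) (S l) < (1/2) ^ i"
      using y(2,3) below_sound[OF y(4)]
      by (intro exI[of _ l] conjI) (simp_all add: S_def power_divide)
  next
    assume "\<exists>l\<ge>h. Y \<in> S l \<and> measure (f Z) (S l) < (1/2) ^ i"
    then obtain l where l: "h \<le> l" "Y \<in> S l" "measure (f Z) (S l) < (1/2) ^ i" by blast
    have "measure (f Z) {X. settled a h e l (prefix_num X l)} < real 1 / real (2 ^ i)"
      using l(3) by (simp add: S_def power_divide)
    from below_complete[OF _ this] obtain n where "below (prefix_num Z n) n (settled a h e l) l 1
        (2 ^ i)" by auto
    moreover have "settled a h e l (prefix_num Y l mod 2 ^ l)" using l(2) prefix_num_less[of Y l]
        by (simp add: S_def)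
    ultimately have "(i, bits (prefix_num Y l) l) \<in> W" unfolding W_def using l(1) by blast
    moreover have "Y \<in> cyl (bits (prefix_num Y l) l)" by (simp add: mem_cyl bits_prefix_num)
    ultimately show "Y \<in> test_level W i" unfolding test_level_def by blast
  qed
  have decr: "S l' \<subseteq> S l" if "h \<le> l" "l \<le> l'" for l l'
    using that by (auto simp: S_def settled_prefix_num)
  have "measure (f Z) (test_level W i) \<le> (1/2) ^ i" for i
  proof -
    \<comment> \<open>The approximations decrease, so the first one of measure below
      \<open>(1/2) ^ i\<close> contains the whole level and bounds its measure.\<close>
    define l where "l = (LEAST l. h \<le> l \<and> measure (f Z) (S l) < (1/2) ^ i)"
    have l: "h \<le> l \<and> measure (f Z) (S l) < (1/2) ^ i"
      unfolding l_def by (rule LeastI_ex) (use small[of i] in blast)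
    have "test_level W i \<subseteq> S l"
    proof
      fix Y assume "Y \<in> test_level W i"
      then obtain l' where l': "h \<le> l'" "Y \<in> S l'" "measure (f Z) (S l') < (1/2) ^ i"
          unfolding mem by blast
      then have "l \<le> l'" unfolding l_def by (intro Least_le) blast
      then show "Y \<in> S l" using decr[of l l'] l l'(2) by blast
    qed
    moreover have "S l \<in> sets (f Z)" unfolding S_def f_sets by (rule clopen_borel)
    ultimately have "measure (f Z) (test_level W i) \<le> measure (f Z) (S l)"
      by (intro finite_measure_mono) auto
    then show ?thesis using l by linarith
  qed
  with ce have "ml_test (f Z) W" by (simp add: ml_test_def)
  moreover have "X \<in> S l" if "h \<le> l" for l using a that by (simp add: S_def settled_prefix_num)
  then have "X \<in> test_level W i" for i unfolding mem using small[of i] by blast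
  ultimately show False using X unfolding ml_random_def by blast
qed

text \<open>Continuity from above: the intersection of the decreasing approximations still has
  measure at least \<open>(1/2) ^ j\<close>, so it contains a random real. Indexing by
  \<open>h + l\<close> starts the sequence at length \<open>h\<close>.\<close>

lemma settled_contains_random:
  assumes "\<And>l. l \<ge> h \<Longrightarrow> (1/2) ^ j \<le> measure (f Z) {Y. settled a h e l (prefix_num Y l)}"
  shows "\<exists>X. ml_random (f Z) X \<and> (\<forall>i\<ge>h. V (X \<restriction> i) = e)"
proof -
  interpret prob_space "f Z" using f_prob by (simp add: prob_measures_def)
  define S where "S l = {Y. settled a h e (h + l) (prefix_num Y (h + l))}" for l
  have S: "range S \<subseteq> sets (f Z)" unfolding S_def f_sets by (auto intro: clopen_borel)
  have "decseq S" unfolding decseq_def S_def by (auto simp: settled_prefix_num)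
  from finite_Lim_measure_decseq[OF S this]
  have "(\<lambda>l. measure (f Z) (S l)) \<longlonglongrightarrow> measure (f Z) (\<Inter>l. S l)" .
  moreover have "(1/2) ^ j \<le> measure (f Z) (S l)" for l using assms[of "h + l"] by (simp add: S_def)
  ultimately have "(1/2) ^ j \<le> measure (f Z) (\<Inter>l. S l)"
    by (intro LIMSEQ_le_const) auto
  then have "measure (f Z) (\<Inter>l. S l) > 0" by (rule less_le_trans[rotated]) simp
  moreover have "(\<Inter>l. S l) \<in> sets borel"
    using S unfolding f_sets by (intro sets.countable_INT) auto
  ultimately obtain X where X: "X \<in> (\<Inter>l. S l)" "ml_random (f Z) X"
    using positive_contains_random[OF f_prob] by blast
  have "V (X \<restriction> i) = e" if "h \<le> i" for i
  proof -
    have "X \<in> S (i - h)" using X(1) by blast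
    then show ?thesis using that by (auto simp: S_def settled_prefix_num)
  qed
  with X(2) show ?thesis by blast
qed

end

section \<open>Computing a real in \<open>D\<close> from an index of its image\<close>

lemma prefix_num_cong: "X \<restriction> n = Y \<restriction> n \<Longrightarrow> prefix_num X n = prefix_num Y n"
  unfolding prefix_num_horner by simp

text \<open>The factor 2 ensures that a value within \<open>(1/2) ^ k\<close> of the first measure
  still misses the second by more than \<open>(1/2) ^ k\<close>.\<close>

lemma prob_measures_differ:
  assumes "\<mu> \<in> prob_measures" "\<nu> \<in> prob_measures" "\<mu> \<noteq> \<nu>"
  shows "\<exists>\<sigma> k. 2 * (1/2) ^ k < \<bar>measure \<mu> (cyl \<sigma>) - measure \<nu> (cyl \<sigma>)\<bar>"
proof -
  obtain \<sigma> where "measure \<mu> (cyl \<sigma>) \<noteq> measure \<nu> (cyl \<sigma>)"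
    using prob_measures_eqI[OF assms(1,2)] assms(3) by blast
  then have "0 < \<bar>measure \<mu> (cyl \<sigma>) - measure \<nu> (cyl \<sigma>)\<bar> / 2" by simp
  from real_arch_pow_inv[OF this, of "1/2"] obtain k
    where "(1/2) ^ k < \<bar>measure \<mu> (cyl \<sigma>) - measure \<nu> (cyl \<sigma>)\<bar> / 2" by auto
  moreover have "x < d / 2 \<Longrightarrow> 2 * x < d" for x d :: real by simp
  ultimately have "2 * (1/2) ^ k < \<bar>measure \<mu> (cyl \<sigma>) - measure \<nu> (cyl \<sigma>)\<bar>" by blast
  then show ?thesis by blast
qed

context measure_map
begin

text \<open>If \<open>e\<close> is an index of \<open>f Z\<close> with \<open>Z\<close> in
  \<open>D\<close>, then injectivity makes \<open>Z\<close> the only real in \<open>D\<close> that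
  never conflicts with \<open>e\<close>. By compactness all strings with a wrong bit
  \<open>i\<close> are killed by some stage, which determines \<open>Z i\<close>. This is uniform in
  \<open>e\<close>, and the acceptable numbering turns it into \<open>s\<close>.\<close>

lemma index_decoder:
  assumes \<phi>: "acceptable_numbering \<phi>" and D: "effectively_closed D" and inj: "inj_on f D"
  shows "\<exists>s :: nat \<Rightarrow> nat. computable s \<and>
    (\<forall>e. \<forall>Z\<in>D. measure_index m e (f Z) \<longrightarrow> real_index \<phi> (s e) Z)"
proof -
  obtain W where W: "ce W" "- D = (\<Union>\<sigma>\<in>W. cyl \<sigma>)"
    using D unfolding effectively_closed_def by blast
  obtain P where P: "semidec P" "\<And>\<sigma>. P (encode \<sigma>) \<longleftrightarrow> \<sigma> \<in> W" using semidec_ce[OF W(1)] by blast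
  define K where "K c \<longleftrightarrow> P (encode (bits (proj1 (proj2 c)) (proj2 (proj2 c)))) \<or> conflict (proj1 c)
      (proj1 (proj2 c)) (proj2 (proj2 c))" for c
  have "semidec K" unfolding K_def by (intro semidec_intros semidec_comp[OF P(1)] semidec_conflict
      rec_intros)
  then obtain Q where Q: "decidable (\<lambda>z. Q (proj1 z) (proj2 z))" "\<And>c. K c \<longleftrightarrow> (\<exists>s. Q c s)"
      unfolding semidec_def by blast
  have kill_iff: "(\<exists>n. stage Q e (prefix_num Y n) n) \<longleftrightarrow>
      (\<exists>n. Y \<restriction> n \<in> W \<or> conflict e (prefix_num Y n) n)" for e Y
    unfolding stage_iff Q(2)[symmetric] by (simp add: K_def P(2) bits_prefix_num)
  have in_W: "(\<exists>n. Y \<restriction> n \<in> W) \<longleftrightarrow> Y \<notin> D" for Y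
  proof -
    have "Y \<in> - D \<longleftrightarrow> (\<exists>\<sigma>\<in>W. Y \<restriction> length \<sigma> = \<sigma>)" unfolding W(2) by (simp add: mem_cyl)
    also have "\<dots> \<longleftrightarrow> (\<exists>n. Y \<restriction> n \<in> W)" by (metis length_restr)
    finally show ?thesis by simp
  qed
  have alive: "\<not> stage Q e (prefix_num Z n) n" if "Z \<in> D" "measure_index m e (f Z)" for Z e n
    using kill_iff[of e Z] in_W[of Z] that conflict_sound[of e Z] by blast
  have killed: "\<exists>n. stage Q e (prefix_num Y n) n" if Z: "Z \<in> D" "measure_index m e
      (f Z)" "Y \<noteq> Z" for Z e Y
  proof (cases "Y \<in> D")
    case True
    then have "f Z \<noteq> f Y" using inj Z by (auto dest: inj_onD)
    from prob_measures_differ[OF f_prob f_prob this] obtain \<sigma> k where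
      far: "2 * (1/2) ^ k < \<bar>measure (f Z) (cyl \<sigma>) - measure (f Y) (cyl \<sigma>)\<bar>" by blast
    obtain q where q: "m e \<sigma> k = Some q" "\<bar>of_rat q - measure (f Z) (cyl \<sigma>)\<bar> \<le> (1/2) ^ k"
      using Z(2) unfolding measure_index_def by blast
    have "\<bar>of_rat q - measure (f Y) (cyl \<sigma>)\<bar> > (1/2) ^ k" using far q(2) by linarith
    from conflict_complete[OF q(1) this] show ?thesis unfolding kill_iff by blast
  next
    case False
    then show ?thesis using in_W[of Y] unfolding kill_iff by blast
  qed
  \<comment> \<open>\<open>x\<close> codes \<open>e\<close> and the position \<open>i\<close>, and
    \<open>t\<close> a candidate bit and a length \<open>n\<close>: every string of length
    \<open>n\<close> with the other bit at \<open>i\<close> is killed by stage \<open>n\<close>. A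
    first component of \<open>t\<close> other than 1 stands for the bit 0.\<close>
  define T where "T x t \<longleftrightarrow> proj2 x < proj2 t \<and> (\<forall>y<2 ^ proj2 t.
      (bit y (proj2 x) \<and> proj1 t \<noteq> 1) \<or> (\<not> bit y (proj2 x) \<and>
          proj1 t = 1) \<longrightarrow> stage Q (proj1 x) y (proj2 t))" for x t
  have T: "decidable (\<lambda>z. T (proj1 z) (proj2 z))"
    unfolding T_def by (intro rec_intros decidable_stage Q(1))
  define g where "g e i = (if \<exists>t. T (prod_encode (e, i)) t
      then Some (proj1 (LEAST t. T (prod_encode (e, i)) t) = 1) else None)" for e i
  have "pcomputable (\<lambda>(e, i). g e i)"
    unfolding pcomputable_def
  proof (intro exI conjI allI)
    show "partrec (\<lambda>x. if \<exists>t. T x t then Some (of_bool (proj1 (proj2 (prod_encode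
        (x, LEAST t. T x t))) = 1)) else None)"
      by (rule partrec_search_then[OF T, of "\<lambda>z. of_bool (proj1 (proj2 z) = 1)"]) (intro rec_intros)
    show "(if \<exists>t. T (encode x) t
        then Some (of_bool (proj1 (proj2 (prod_encode (encode x, LEAST t. T (encode x) t))) =
            1)) else None) =
      map_option encode (case x of (e, i) \<Rightarrow> g e i)" for x :: "nat \<times> nat"
      by (cases x) (simp add: g_def encode_prod_def encode_bool_def)
  qed
  with \<phi> obtain s :: "nat \<Rightarrow> nat" where s: "computable s" "\<And>e. \<phi> (s e) = g e"
    unfolding acceptable_numbering_def by blast
  have "g e i = Some (Z i)" if Z: "Z \<in> D" "measure_index m e (f Z)" for e Z i
  proof -
    \<comment> \<open>Requiring \<open>i < n\<close> makes the property depend only on the first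
      \<open>n\<close> bits of \<open>X\<close>, as compactness demands.\<close>
    have "\<exists>n. \<forall>X. i < n \<and> (X i \<noteq> Z i \<longrightarrow> stage Q e (prefix_num X n) n)"
    proof (rule koenig)
      show "i < n \<and> (Y i \<noteq> Z i \<longrightarrow> stage Q e (prefix_num Y n) n)"
        if "X \<restriction> n = Y \<restriction> n" "i < n \<and> (X i \<noteq> Z i \<longrightarrow> stage Q e (prefix_num X n) n)" for X Y n
        using that prefix_num_cong[OF that(1)] unfolding restr_eq_iff by metis
      show "i < n' \<and> (X i \<noteq> Z i \<longrightarrow> stage Q e (prefix_num X n') n')"
        if "i < n \<and> (X i \<noteq> Z i \<longrightarrow> stage Q e (prefix_num X n) n)" "n \<le> n'" for X n n'
        using that stage_mono[of Q e X n n'] by auto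
      show "\<exists>n. i < n \<and> (X i \<noteq> Z i \<longrightarrow> stage Q e (prefix_num X n) n)" for X
      proof (cases "X = Z")
        case False
        from killed[OF Z False] obtain n where "stage Q e (prefix_num X n) n" by blast
        then have "stage Q e (prefix_num X (max n (Suc i))) (max n (Suc i))" by (rule stage_mono) simp
        then show ?thesis by (intro exI[of _ "max n (Suc i)"]) auto
      qed auto
    qed
    then obtain n where n: "i < n" "\<And>X. X i \<noteq> Z i \<Longrightarrow> stage Q e (prefix_num X n) n" by blast
    have "T (prod_encode (e, i)) (prod_encode (of_bool (Z i), n))"
      unfolding T_def proj1_pair proj2_pair
    proof (intro conjI n(1) allI impI)
      fix y :: nat
      assume "y < 2 ^ n" "bit y i \<and> of_bool (Z i) \<noteq> (1::nat) \<or> \<not> bit y i \<and> of_bool (Z i) = (1::nat)"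
      then show "stage Q e y n" using n(2)[of "bit y"] by (cases "Z i") (auto simp: prefix_num_bit)
    qed
    then have ex: "\<exists>t. T (prod_encode (e, i)) t" by blast
    \<comment> \<open>Prefixes of \<open>Z\<close> are never killed, so a verified candidate bit
      cannot be wrong.\<close>
    have "(proj1 t = 1) = Z i" if "T (prod_encode (e, i)) t" for t
    proof (rule ccontr)
      assume ne: "(proj1 t = 1) \<noteq> Z i"
      have "i < proj2 t" using that by (simp add: T_def)
      then have "bit (prefix_num Z (proj2 t)) i = Z i" by (rule bit_prefix_num)
      then have "stage Q e (prefix_num Z (proj2 t)) (proj2 t)"
        using that ne prefix_num_less[of Z "proj2 t"] unfolding T_def proj1_pair proj2_pair by blast
      then show False using alive[OF Z] by blast
    qed
    from this[OF LeastI_ex[OF ex]] show ?thesis using ex by (simp add: g_def)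
  qed
  then have "real_index \<phi> (s e) Z" if "Z \<in> D" "measure_index m e (f Z)" for e Z
    using that by (simp add: real_index_def s(2) fun_eq_iff)
  with s(1) show ?thesis by blast
qed

end

section \<open>The learner\<close>

lemma total_rec_computable_nat:
  fixes s :: "nat \<Rightarrow> nat"
  assumes "computable s" shows "total_rec s"
proof -
  obtain k where "partrec k" "\<And>x. k x = Some (s x)"
    using assms unfolding computable_def pcomputable_def by auto
  then have "(\<lambda>x. Some (s x)) = k" by auto
  with \<open>partrec k\<close> show ?thesis by (simp add: total_rec_def)
qed

text \<open>A string is decoded by searching for a pair of numbers that represents it; by
  \<open>cong\<close> the value does not depend on which representation is found.\<close>

lemma computable_from_prefix_code:
  assumes "total_rec L" and cong: "\<And>x y n. bits x n = bits y n \<Longrightarrow>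
      L (prod_encode (x, n)) = L (prod_encode (y, n))"
  shows "\<exists>L' :: bool list \<Rightarrow> nat. computable L' \<and>
      (\<forall>Z n. L' (Z \<restriction> n) = L (prod_encode (prefix_num Z n, n)))"
proof (intro exI conjI allI)
  let ?Q = "\<lambda>c z. encode (bits (proj1 z) (proj2 z)) = c"
  let ?L = "\<lambda>\<sigma> :: bool list. L (LEAST z. ?Q (encode \<sigma>) z)"
  have Q: "decidable (\<lambda>z. ?Q (proj1 z) (proj2 z))" by (intro rec_intros)
  have ex: "\<exists>z. ?Q (encode \<sigma>) z" for \<sigma> :: "bool list"
  proof -
    obtain x where "\<sigma> = bits x (length \<sigma>)" by (rule bits_cases)
    then show ?thesis by (metis proj1_pair proj2_pair)
  qed
  show "computable ?L"
    unfolding computable_def pcomputable_def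
  proof (intro exI conjI allI)
    show "partrec (\<lambda>c. if \<exists>z. ?Q c z then Some (L (proj2 (prod_encode
        (c, LEAST z. ?Q c z)))) else None)"
      by (rule partrec_search_then[OF Q, of "\<lambda>z. L (proj2 z)"])
          (intro total_rec_comp[OF assms(1)] rec_intros)
  qed (use ex in simp)
  show "?L (Z \<restriction> n) = L (prod_encode (prefix_num Z n, n))" for Z n
  proof -
    define z where "z = (LEAST z. ?Q (encode (Z \<restriction> n)) z)"
    have "encode (bits (proj1 z) (proj2 z)) = encode (Z \<restriction> n)"
      unfolding z_def by (rule LeastI_ex[OF ex])
    then have eq: "bits (proj1 z) (proj2 z) = Z \<restriction> n" by (simp add: inj_eq[OF inj_encode])
    then have n: "proj2 z = n" by (metis length_restr length_bits)
    have "L (prod_encode (proj1 z, n)) = L (prod_encode (prefix_num Z n, n))"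
      by (rule cong) (use eq n in \<open>simp add: bits_prefix_num\<close>)
    then show ?thesis unfolding z_def[symmetric] using n pair_proj1_proj2[of z] by simp
  qed
qed

theorem theorem3p10:
  fixes \<phi> :: "nat \<Rightarrow> nat \<Rightarrow> bool option"
    and m :: "nat \<Rightarrow> bool list \<Rightarrow> nat \<Rightarrow> rat option"
    and f :: "(nat \<Rightarrow> bool) \<Rightarrow> (nat \<Rightarrow> bool) measure"
    and D Dstar :: "(nat \<Rightarrow> bool) set"
  assumes "acceptable_numbering \<phi>"
    and "uniform_measure_enumeration m"
    and "computable_measure_map f"
    and "effectively_closed D"
    and "inj_on f D"
    and "Dstar \<subseteq> D"
    and "\<forall>Z\<in>Dstar. computable Z"
    and "partially_EX_learnable m (f ` Dstar)"
  shows "EX_learnable \<phi> Dstar"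
proof -
  obtain F where F: "computable F" "\<And>Z n. f Z \<in> basic_open (F (Z \<restriction> n))"
    "\<And>Z. (\<lambda>n. measure_diam (basic_open (F (Z \<restriction> n)))) \<longlonglongrightarrow> 0"
    using assms(3) unfolding computable_measure_map_def by blast
  obtain V where V: "computable V" and
    Va: "\<forall>\<mu>\<in>f ` Dstar. \<forall>X. ml_random \<mu> X \<longrightarrow> (\<exists>e \<mu>'. (\<lambda>n. V (X \<restriction> n)) \<longlonglongrightarrow> e \<and>
      computable_measure \<mu>' \<and> measure_index m e \<mu>' \<and> ml_random \<mu>' X)" and
    Vb: "\<forall>\<mu>\<in>f ` Dstar. \<exists>X e. ml_random \<mu> X \<and> (\<lambda>n. V (X \<restriction> n)) \<longlonglongrightarrow> e \<and> measure_index m e \<mu>"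
    using assms(8) unfolding partially_EX_learnable_def by (elim conjE exE)
  have m: "pcomputable (\<lambda>(e, \<sigma>, k). m e \<sigma> k)"
    using assms(2) by (simp add: uniform_measure_enumeration_def)
  interpret measure_map f F m V
    by unfold_locales (use F V m in auto)
  obtain s :: "nat \<Rightarrow> nat" where s: "computable s"
    "\<And>e Z. Z \<in> D \<Longrightarrow> measure_index m e (f Z) \<Longrightarrow> real_index \<phi> (s e) Z"
    using index_decoder[OF assms(1,4,5)] by blast
  text \<open>A hypothesis \<open>t\<close> codes \<open>(a, h, e, j)\<close>: the reals extending the string \<open>bits a h\<close> on which
    \<open>V\<close> has constant value \<open>e\<close> from length \<open>h\<close> on have measure at least \<open>2^-j\<close>, and \<open>e\<close> is an
    index of the measure.\<close>
  define R where "R c \<longleftrightarrow> conflict (proj1 (proj2 (proj2 (proj1 c)))) (proj1 (proj2 c)) (proj2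
      (proj2 c)) \<or>
    (\<exists>l. proj1 (proj2 (proj1 c)) \<le> l \<and> below (proj1 (proj2 c)) (proj2 (proj2 c))
       (settled (proj1 (proj1 c)) (proj1 (proj2 (proj1 c))) (proj1 (proj2 (proj2
           (proj1 c)))) l) l 1 (2 ^ proj2 (proj2 (proj2 (proj1 c)))))" for c
  have "semidec R"
    unfolding R_def
    by (intro semidec_intros semidec_conflict semidec_below decidable_semidec rec_intros)
  then obtain Q where Q: "decidable (\<lambda>z. Q (proj1 z) (proj2 z))" "\<And>c. R c \<longleftrightarrow> (\<exists>s. Q c s)"
      unfolding semidec_def by blast
  \<comment> \<open>The output is the real index translated from the least hypothesis not yet
    refuted. The alternative \<open>proj2 z < t\<close> makes the search end; it does not affect the
    limit, as the length of the prefix eventually reaches the final hypothesis.\<close>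
  define L where "L z = s (proj1 (proj2 (proj2 (LEAST t. proj2 z < t \<or> \<not> stage Q t (proj1 z)
      (proj2 z)))))" for z
  have "total_rec (\<lambda>z. LEAST t. proj2 z < t \<or> \<not> stage Q t (proj1 z) (proj2 z))"
  proof (rule total_rec_Least)
    show "decidable (\<lambda>z. proj2 (proj1 z) < proj2 z \<or> \<not> stage Q (proj2 z) (proj1 (proj1 z)) (proj2
        (proj1 z)))"
      by (intro rec_intros decidable_stage[OF Q(1)])
    show "\<exists>t. proj2 z < t \<or> \<not> stage Q t (proj1 z) (proj2 z)" for z
      by (rule exI[of _ "Suc (proj2 z)"]) simp
  qed
  then have "total_rec L"
    unfolding L_def by (intro total_rec_comp[OF total_rec_computable_nat[OF s(1)]] total_rec_proj1
        total_rec_proj2)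
  moreover have "L (prod_encode (x, n)) = L (prod_encode (y, n))" if "bits x n = bits y n" for x y n
    unfolding L_def proj1_pair proj2_pair stage_cong[OF that] ..
  ultimately obtain L' :: "bool list \<Rightarrow> nat" where L': "computable L'"
    "\<And>Z n. L' (Z \<restriction> n) = L (prod_encode (prefix_num Z n, n))"
    using computable_from_prefix_code by blast
  have "\<exists>e. (\<lambda>n. L' (Z \<restriction> n)) \<longlonglongrightarrow> e \<and> real_index \<phi> e Z" if Z: "Z \<in> Dstar" for Z
  proof -
    define U where "U t \<longleftrightarrow> (\<forall>n. \<not> stage Q t (prefix_num Z n) n)" for t
    have U_iff: "U (prod_encode (a, prod_encode (h, prod_encode (e, j)))) \<longleftrightarrow>
        \<not> (\<exists>n. conflict e (prefix_num Z n) n) \<and>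
        (\<forall>l\<ge>h. (1/2) ^ j \<le> measure (f Z) {Y. settled a h e l (prefix_num Y l)})" for a h e j
    proof -
      have below: "(\<exists>n. below (prefix_num Z n) n (settled a h e l) l 1 (2 ^ j)) \<longleftrightarrow>
          measure (f Z) {Y. settled a h e l (prefix_num Y l)} < (1/2) ^ j" for l
        using below_sound[of Z _ "settled a h e l" l 1 "2 ^ j"] below_complete[of "2 ^ j" Z
            "settled a h e l" l 1]
        by (auto simp: power_divide)
      have "U (prod_encode (a, prod_encode (h, prod_encode (e, j)))) \<longleftrightarrow>
          \<not> (\<exists>n. R (prod_encode (prod_encode (a, prod_encode (h, prod_encode (e, j))), prod_encode
              (prefix_num Z n, n))))"
        unfolding U_def Q(2) stage_iff[symmetric] by blast
      also have "\<dots> \<longleftrightarrow> \<not> (\<exists>n. conflict e (prefix_num Z n) n) \<and>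
          \<not> (\<exists>l\<ge>h. \<exists>n. below (prefix_num Z n) n (settled a h e l) l 1 (2 ^ j))"
        unfolding R_def proj1_pair proj2_pair by blast
      finally show ?thesis unfolding below by (simp add: not_less)
    qed
    have exU: "\<exists>t. U t"
    proof -
      obtain X e where X: "ml_random (f Z) X" "(\<lambda>n. V (X \<restriction> n)) \<longlonglongrightarrow> e" "measure_index m e (f Z)"
        using Vb[rule_format, OF imageI[OF Z]] by blast
      \<comment> \<open>The length after which \<open>V\<close> no longer changes on
        \<open>X\<close> fixes the string of the hypothesis, and the random real \<open>X\<close>
        keeps the corresponding class from being null.\<close>
      from X(2) obtain h where h: "\<And>i. h \<le> i \<Longrightarrow> V (X \<restriction> i) = e"
        unfolding tendsto_discrete eventually_sequentially by blast
      from random_settled_positive[OF _ X(1) refl h] assms(7) Z obtain j where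
        "\<forall>l\<ge>h. (1/2) ^ j \<le> measure (f Z) {Y. settled (prefix_num X h) h e l
            (prefix_num Y l)}" by blast
      then show ?thesis using U_iff[of "prefix_num X h" h e j] conflict_sound X(3) by blast
    qed
    define t where "t = (LEAST t. U t)"
    have Ut: "U t" unfolding t_def by (rule LeastI_ex[OF exU])
    define e where "e = proj1 (proj2 (proj2 t))"
    have t: "t = prod_encode (proj1 t, prod_encode (proj1 (proj2 t), prod_encode (e, proj2 (proj2
        (proj2 t)))))"
      by (simp add: e_def)
    have "U (prod_encode (proj1 t, prod_encode (proj1 (proj2 t), prod_encode (e, proj2 (proj2
        (proj2 t))))))"
      using Ut by (simp add: e_def)
    from this[unfolded U_iff] have nc: "\<And>n. \<not> conflict e (prefix_num Z n) n"
      and pos: "\<And>l. proj1 (proj2 t) \<le> l \<Longrightarrow>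
        (1/2) ^ proj2 (proj2 (proj2 t)) \<le> measure (f Z) {Y. settled (proj1 t) (proj1
            (proj2 t)) e l (prefix_num Y l)}" by blast+
    obtain X where X: "ml_random (f Z) X" "\<forall>i\<ge>proj1 (proj2 t). V (X \<restriction> i) = e"
      using settled_contains_random[OF pos] by blast
    \<comment> \<open>Clause (a) applies to this \<open>X\<close>, whichever measure
      \<open>\<mu>'\<close> its limit describes. Since \<open>V\<close> settles on \<open>e\<close>
      along \<open>X\<close>, the index \<open>e\<close> is total.\<close>
    obtain e' \<mu>' where e': "(\<lambda>n. V (X \<restriction> n)) \<longlonglongrightarrow> e'" "measure_index m e' \<mu>'"
      using Va[rule_format, OF imageI[OF Z] X(1)] by blast
    have "(\<lambda>n. V (X \<restriction> n)) \<longlonglongrightarrow> e"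
      unfolding tendsto_discrete eventually_sequentially using X(2) by blast
    with e' have "measure_index m e \<mu>'" using LIMSEQ_unique by blast
    then have total: "\<And>\<sigma> k. \<exists>q. m e \<sigma> k = Some q" unfolding measure_index_def by blast
    \<comment> \<open>Every value is defined and none conflicts with \<open>f Z\<close>, so all of
      them are accurate for \<open>f Z\<close> itself.\<close>
    have ind: "measure_index m e (f Z)"
      unfolding measure_index_def
    proof (intro conjI f_prob allI)
      fix \<sigma> k
      obtain q where q: "m e \<sigma> k = Some q" using total by blast
      then have "\<bar>of_rat q - measure (f Z) (cyl \<sigma>)\<bar> \<le> (1/2) ^ k"
        using conflict_complete[OF q, of Z] nc by (meson not_le)
      with q show "\<exists>q. m e \<sigma> k = Some q \<and> \<bar>of_rat q - measure (f Z) (cyl \<sigma>)\<bar> \<le> (1/2) ^ k" by blast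
    qed
    have "\<forall>t'\<in>{..<t}. \<exists>n. stage Q t' (prefix_num Z n) n"
      using not_less_Least[of _ U] unfolding t_def U_def by blast
    from bchoice[OF this] obtain N where N: "\<And>t'. t' < t \<Longrightarrow> stage Q t' (prefix_num Z (N t')) (N t')"
      by blast
    \<comment> \<open>From \<open>n0\<close> on, every hypothesis below \<open>t\<close> is refuted
      and \<open>t\<close> lies within the search bound.\<close>
    define n0 where "n0 = Max (insert t (N ` {..<t}))"
    have "L' (Z \<restriction> n) = s e" if "n0 \<le> n" for n
    proof -
      have Nn: "N t' \<le> n" if "t' < t" for t'
        using \<open>n0 \<le> n\<close> that by (auto simp: n0_def)
      have tn: "t \<le> n" using \<open>n0 \<le> n\<close> by (auto simp: n0_def)
      have "(LEAST t. n < t \<or> \<not> stage Q t (prefix_num Z n) n) = t"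
      proof (rule Least_equality)
        show "n < t \<or> \<not> stage Q t (prefix_num Z n) n" using Ut unfolding U_def by blast
        fix t' assume t': "n < t' \<or> \<not> stage Q t' (prefix_num Z n) n"
        show "t \<le> t'"
        proof (rule ccontr)
          assume "\<not> t \<le> t'"
          then have "t' < t" by simp
          from stage_mono[OF N[OF this] Nn[OF this]] t' tn \<open>t' < t\<close> show False by simp
        qed
      qed
      then show ?thesis by (simp add: L'(2) L_def e_def)
    qed
    then have "(\<lambda>n. L' (Z \<restriction> n)) \<longlonglongrightarrow> s e"
      unfolding tendsto_discrete eventually_sequentially by blast
    moreover have "real_index \<phi> (s e) Z" using s(2)[OF _ ind] Z assms(6) by blast
    ultimately show ?thesis by blast
  qed
  then show ?thesis
    unfolding EX_learnable_def by (intro conjI assms(7) exI[of _ L'] L'(1) ballI)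
qed

end
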